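(* Fix an integer $L\ge 1$ and a number $A>0$. For $N\ge 1$ let $p_N$ be the density of zeros of the random polynomial $\psi_N$ defined in the context. Then, as $N\to\infty$, \[ N^{-2}\,p_N\!\left(\Bigl(1+\frac{s}{N}\Bigr)^{1/2}e^{i\theta}\right)=\frac1\pi\left[\frac{g^{(L)}(s)}{g^{(L-1)}(s)}\right]'+O(N^{-1}), \] where the error term is bounded by $C(A,L)N^{-1}$ uniformly in $s\in[-A,A]$ and $\theta\in\mathbb R$, the prime denotes $d/ds$, and \[ g(s)=\frac{e^s-1}{s}=\sum_{j\ge0}\frac{s^j}{(j+1)!},\qquad g^{(j)}(s)=\frac{d^j g}{ds^j}(s). \] Equivalently, the leading term equals $\frac1\pi\bigl[\log g^{(L-1)}(s)\bigr]''$.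
   Context: A standard complex Gaussian random variable $a$ satisfies $Ea=0$, $E|a|^2=1$, $Ea^2=0$. Let $(a_m)_{m\ge0}$ be independent standard complex Gaussian random variables and $L\ge1$ a fixed integer. The $SU(1,1)$ random polynomial of degree $N$ is \[ \psi_N(z)=\sum_{m=0}^N\sqrt{\binom{m+L-1}{m}}\,a_m z^m,\qquad \binom{m+L-1}{m}=\frac{(m+L-1)!}{(L-1)!\,m!}. \] Its density of zeros $p_N:\mathbb C\to[0,\infty)$ is the function such that for every smooth compactly supported test function $\phi$ on $\mathbb C$, $E\bigl(\sum_{j=1}^N\phi(z_j)\bigr)=\int_{\mathbb C}p_N(z)\phi(z)\,dx\,dy$, where $z_1,\dots,z_N$ are the zeros of $\psi_N$ (counted with multiplicity). *)

theory Defs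
  imports "HOL-Probability.Probability" "HOL-Computational_Algebra.Polynomial"
begin

text \<open>Smooth (C-infinity) real-valued functions on the complex plane (viewed as R^2):
  differentiable everywhere, with both partial derivatives (directions 1 and i) again smooth.
  This is the greatest fixed point, i.e. derivatives of all orders exist.\<close>
coinductive smooth_C :: "(complex \<Rightarrow> real) \<Rightarrow> bool" where
  "(\<forall>z. f differentiable (at z)) \<Longrightarrow>
   smooth_C (\<lambda>z. frechet_derivative f (at z) 1) \<Longrightarrow>
   smooth_C (\<lambda>z. frechet_derivative f (at z) \<i>) \<Longrightarrow> smooth_C f"

definition test_function :: "(complex \<Rightarrow> real) \<Rightarrow> bool" where
  "test_function \<phi> \<longleftrightarrow> smooth_C \<phi> \<and> compact (closure {z. \<phi> z \<noteq> 0})"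

text \<open>Density of the standard complex Gaussian: E a = 0, E|a|^2 = 1, E a^2 = 0.\<close>
definition std_cgauss_density :: "complex \<Rightarrow> real" where
  "std_cgauss_density z = exp (- ((cmod z)\<^sup>2)) / pi"

definition su11_poly :: "nat \<Rightarrow> nat \<Rightarrow> (nat \<Rightarrow> complex) \<Rightarrow> complex poly" where
  "su11_poly L N a = Poly (map (\<lambda>m. complex_of_real (sqrt (real ((m + L - 1) choose m))) * a m) [0..<N+1])"

definition zero_sum :: "complex poly \<Rightarrow> (complex \<Rightarrow> real) \<Rightarrow> real" where
  "zero_sum P \<phi> = (\<Sum>z\<in>{z. poly P z = 0}. real (order z P) * \<phi> z)"

definition g_fun :: "real \<Rightarrow> real" where
  "g_fun s = (if s = 0 then 1 else (exp s - 1) / s)"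

end

theory Submission
  imports Defs
    "HOL-Complex_Analysis.Complex_Analysis"
    "HOL-Computational_Algebra.Fundamental_Theorem_Algebra"
    "HOL-Real_Asymp.Real_Asymp"
begin

text \<open>
  Let \<open>K x = (\<Sum>m\<le>N. (m+L-1 choose m) x\<^sup>m)\<close>, so that \<open>\<psi> z\<close> is a centred complex Gaussian of variance
  \<open>K (|z|\<^sup>2)\<close> and \<open>E ln |\<psi> z| = ln (K (|z|\<^sup>2)) / 2 + const\<close>. Testing against bumps
  \<open>h (|z - z0|\<^sup>2)\<close> that are radial about \<open>z0\<close>, Jensen's formula expresses the smoothed number of zeros
  through the circle means of \<open>ln |\<psi>|\<close> around \<open>z0\<close>. Taking expectations and shrinking the bump gives
  \<open>\<pi> p z0 = d/dx (x d/dx ln (K x))\<close> at \<open>x = |z0|\<^sup>2\<close>.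
  For \<open>x = 1 + s / N\<close> the derivatives of \<open>K\<close>, suitably normalised, are Riemann sums with error
  \<open>O(1/N)\<close> for \<open>g\<^sup>(\<^sup>n\<^sup>) s = \<integral>\<^sub>0\<^sup>1 t\<^sup>n e\<^bsup>st\<^esup> dt\<close>, which yields the limit.
\<close>

subsection \<open>Smooth radial bump functions\<close>

text \<open>The density is known only through its pairings with smooth test functions, so its
  pointwise value has to come from an approximate identity. Centring the bump at z0 turns the planar
  identity "Laplacian of ln |z - w| is 2 pi times a point mass" into integration by parts in the
  single variable u = |z - z0|^2, with one circle mean per root. The delicate point is the
  interchange of expectation and integration, because ln |psi| is unbounded at the zeros. It is
  settled by a bound on E |ln |psi(z)|| that is uniform on the support of the bump, since the law of
  psi(z) depends on z only through its variance. In the scaling limit, pi p = K'/K + x (K''/K -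
  (K'/K)^2) has terms of size N and N^2, so only the second survives division by N^2. The ratios do
  not feel the normalisation of K, and they converge uniformly because the limiting denominator
  g^(L-1) is bounded away from 0 on [-A, A]. The order L - 1 arises because (m+L-1 choose m) grows
  like m^(L-1) / (L-1)!.\<close>

definition bump :: "nat \<Rightarrow> real \<Rightarrow> real" where
  "bump k t = (if t > 0 then exp (- 1 / t) / t ^ k else 0)"

lemma bump_nonneg: "bump k t \<ge> 0"
  by (simp add: bump_def)

lemma bump_eq_0: "t \<le> 0 \<Longrightarrow> bump k t = 0"
  by (simp add: bump_def)

lemma bump_at_right_0: "(bump k \<longlongrightarrow> 0) (at_right 0)"
proof -
  have "((\<lambda>t::real. inverse t ^ k / exp (inverse t)) \<longlongrightarrow> 0) (at_right 0)"
    by (rule filterlim_compose[OF tendsto_power_div_exp_0 filterlim_inverse_at_top_right])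
  moreover have "eventually (\<lambda>t::real. inverse t ^ k / exp (inverse t) = bump k t) (at_right 0)"
    by (rule eventually_mono[OF eventually_at_right_less])
       (auto simp: bump_def exp_minus field_simps power_inverse)
  ultimately show ?thesis
    by (rule Lim_transform_eventually)
qed

text \<open>The exponent \<open>k\<close> makes the family closed under differentiation: a
  derivative only raises the power of 1/t. At 0 the right difference quotient of
  \<open>bump k\<close> is \<open>bump (Suc k)\<close>, which tends to 0.\<close>

lemma bump_has_derivative:
  "(bump k has_real_derivative - real k * bump (Suc k) t + bump (Suc (Suc k)) t) (at t)"
proof -
  consider "t > 0" | "t < 0" | "t = 0" by linarith
  then show ?thesis
  proof cases
    case 1
    \<comment> \<open>Removes the truncated \<open>k - 1\<close>, so that the quotient rule
      simplifies for all \<open>k\<close> at once.\<close>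
    have pow: "real k * t ^ (k - 1) = real k * t ^ k / t"
      using 1 by (cases k) auto
    have "((\<lambda>t. exp (- 1 / t) / t ^ k) has_real_derivative
        (exp (- 1 / t) * (1 / t\<^sup>2) * t ^ k - exp (- 1 / t) * (real k * t ^ (k - 1))) / (t ^ k * t ^ k)) (at t)"
      using 1 by (auto intro!: derivative_eq_intros simp: power2_eq_square)
    also have "(exp (- 1 / t) * (1 / t\<^sup>2) * t ^ k - exp (- 1 / t) * (real k * t ^ (k - 1))) / (t ^ k * t ^ k) =
        - real k * bump (Suc k) t + bump (Suc (Suc k)) t"
      unfolding pow using 1 by (simp add: bump_def field_simps power2_eq_square)
    finally have "((\<lambda>t. exp (- 1 / t) / t ^ k) has_real_derivative
        - real k * bump (Suc k) t + bump (Suc (Suc k)) t) (at t)" .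
    moreover have "eventually (\<lambda>x. exp (- 1 / x) / x ^ k = bump k x) (nhds t)"
      using eventually_nhds_in_open[of "{0<..}" t] 1
      by (auto elim!: eventually_mono simp: bump_def)
    ultimately show ?thesis
      by (simp only: DERIV_cong_ev[OF refl _ refl])
  next
    case 2
    have "eventually (\<lambda>x. 0 = bump k x) (nhds t)"
      using eventually_nhds_in_open[of "{..<0}" t] 2
      by (auto elim!: eventually_mono simp: bump_def)
    moreover have "((\<lambda>t. 0) has_real_derivative - real k * bump (Suc k) t + bump (Suc (Suc k)) t) (at t)"
      using 2 by (simp add: bump_def)
    ultimately show ?thesis
      by (simp only: DERIV_cong_ev[OF refl _ refl])
  next
    case 3
    have "((\<lambda>h. bump k h / h) \<longlongrightarrow> 0) (at_right 0)"
    proof (rule Lim_transform_eventually[OF bump_at_right_0[of "Suc k"]])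
      show "eventually (\<lambda>x. bump (Suc k) x = bump k x / x) (at_right 0)"
        by (rule eventually_mono[OF eventually_at_right_less]) (auto simp: bump_def field_simps)
    qed
    moreover have "((\<lambda>h. bump k h / h) \<longlongrightarrow> 0) (at_left 0)"
      by (rule Lim_transform_eventually[OF tendsto_const])
         (auto simp: bump_def eventually_at_left_field intro: exI[of _ "-1"])
    ultimately have "((\<lambda>h. bump k h / h) \<longlongrightarrow> 0) (at 0)"
      by (rule filterlim_split_at[rotated])
    then show ?thesis
      using 3 by (simp add: DERIV_def bump_def)
  qed
qed

lemma bump_continuous: "continuous_on S (bump k)"
  by (meson bump_has_derivative DERIV_isCont continuous_at_imp_continuous_on)

lemma bump_measurable [measurable]: "bump k \<in> borel_measurable borel"
  by (rule borel_measurable_continuous_onI[OF bump_continuous])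

lemmas bump_derivative' [derivative_intros] = bump_has_derivative[THEN DERIV_chain2]

text \<open>An algebra containing the radial bumps and closed under both partial derivatives: the
  invariant for the coinductive smoothness proof.\<close>

inductive_set radial_bumps :: "complex \<Rightarrow> real \<Rightarrow> (complex \<Rightarrow> real) set" for z0 \<epsilon> where
  const: "(\<lambda>_. c) \<in> radial_bumps z0 \<epsilon>"
| Re: "Re \<in> radial_bumps z0 \<epsilon>"
| Im: "Im \<in> radial_bumps z0 \<epsilon>"
| bump: "(\<lambda>z. bump k (1 - (cmod (z - z0))\<^sup>2 / \<epsilon>)) \<in> radial_bumps z0 \<epsilon>"
| add: "f \<in> radial_bumps z0 \<epsilon> \<Longrightarrow> g \<in> radial_bumps z0 \<epsilon> \<Longrightarrow> (\<lambda>z. f z + g z) \<in> radial_bumps z0 \<epsilon>"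
| mult: "f \<in> radial_bumps z0 \<epsilon> \<Longrightarrow> g \<in> radial_bumps z0 \<epsilon> \<Longrightarrow> (\<lambda>z. f z * g z) \<in> radial_bumps z0 \<epsilon>"

lemma radial_bumps_deriv:
  assumes "f \<in> radial_bumps z0 \<epsilon>"
  shows "\<exists>f1\<in>radial_bumps z0 \<epsilon>. \<exists>f2\<in>radial_bumps z0 \<epsilon>.
    \<forall>z. (f has_derivative (\<lambda>h. f1 z * Re h + f2 z * Im h)) (at z)"
  using assms
proof induction
  case (const c)
  show ?case
    by (rule bexI[of _ "\<lambda>_. 0"], rule bexI[of _ "\<lambda>_. 0"]) (auto intro: radial_bumps.const)
next
  case Re
  show ?case
    by (rule bexI[of _ "\<lambda>_. 1"], rule bexI[of _ "\<lambda>_. 0"])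
       (auto intro: radial_bumps.const intro!: derivative_eq_intros)
next
  case Im
  show ?case
    by (rule bexI[of _ "\<lambda>_. 0"], rule bexI[of _ "\<lambda>_. 1"])
       (auto intro: radial_bumps.const intro!: derivative_eq_intros)
next
  case (bump k)
  define b where "b = (\<lambda>z. (- real k) * bump (Suc k) (1 - (cmod (z - z0))\<^sup>2 / \<epsilon>) + bump (Suc (Suc k)) (1 - (cmod (z - z0))\<^sup>2 / \<epsilon>))"
  define f1 where "f1 = (\<lambda>z. b z * ((- 2 / \<epsilon>) * (Re z + (- Re z0))))"
  define f2 where "f2 = (\<lambda>z. b z * ((- 2 / \<epsilon>) * (Im z + (- Im z0))))"
  have b: "b \<in> radial_bumps z0 \<epsilon>"
    unfolding b_def by (intro radial_bumps.intros)
  have "f1 \<in> radial_bumps z0 \<epsilon>" "f2 \<in> radial_bumps z0 \<epsilon>"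
    unfolding f1_def f2_def by (intro radial_bumps.intros b)+
  moreover have "((\<lambda>z. Submission.bump k (1 - (cmod (z - z0))\<^sup>2 / \<epsilon>)) has_derivative (\<lambda>h. f1 z * Re h + f2 z * Im h)) (at z)" for z
  proof -
    have "((\<lambda>z. 1 - inverse \<epsilon> * ((Re z - Re z0)^2 + (Im z - Im z0)^2)) has_derivative
      (\<lambda>h. - 2 / \<epsilon> * ((Re z - Re z0) * Re h + (Im z - Im z0) * Im h))) (at z)"
      by (rule derivative_eq_intros refl | simp)+ (simp add: fun_eq_iff algebra_simps divide_inverse)
    hence "((\<lambda>z. 1 - (cmod (z - z0))^2 / \<epsilon>) has_derivative
      (\<lambda>h. - 2 / \<epsilon> * ((Re z - Re z0) * Re h + (Im z - Im z0) * Im h))) (at z)"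
      by (simp add: cmod_power2 divide_inverse mult.commute)
    from has_derivative_compose[OF this bump_has_derivative[unfolded has_field_derivative_def]]
    show ?thesis
      by (rule has_derivative_eq_rhs) (auto simp: f1_def f2_def b_def fun_eq_iff divide_inverse algebra_simps)
  qed
  ultimately show ?case by blast
next
  case (add f g)
  then obtain f1 f2 g1 g2 where *: "f1 \<in> radial_bumps z0 \<epsilon>" "f2 \<in> radial_bumps z0 \<epsilon>"
    "g1 \<in> radial_bumps z0 \<epsilon>" "g2 \<in> radial_bumps z0 \<epsilon>"
    "\<And>z. (f has_derivative (\<lambda>h. f1 z * Re h + f2 z * Im h)) (at z)"
    "\<And>z. (g has_derivative (\<lambda>h. g1 z * Re h + g2 z * Im h)) (at z)" by blast
  show ?case
    by (rule bexI[of _ "\<lambda>z. f1 z + g1 z"], rule bexI[of _ "\<lambda>z. f2 z + g2 z"])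
       (auto intro!: radial_bumps.add * has_derivative_eq_rhs[OF has_derivative_add[OF *(5,6)]] simp: algebra_simps)
next
  case (mult f g)
  then obtain f1 f2 g1 g2 where *: "f1 \<in> radial_bumps z0 \<epsilon>" "f2 \<in> radial_bumps z0 \<epsilon>"
    "g1 \<in> radial_bumps z0 \<epsilon>" "g2 \<in> radial_bumps z0 \<epsilon>"
    "\<And>z. (f has_derivative (\<lambda>h. f1 z * Re h + f2 z * Im h)) (at z)"
    "\<And>z. (g has_derivative (\<lambda>h. g1 z * Re h + g2 z * Im h)) (at z)" by blast
  show ?case
    by (rule bexI[of _ "\<lambda>z. f z * g1 z + f1 z * g z"], rule bexI[of _ "\<lambda>z. f z * g2 z + f2 z * g z"])
       (auto intro!: radial_bumps.add radial_bumps.mult mult * has_derivative_eq_rhs[OF has_derivative_mult[OF *(5,6)]] simp: algebra_simps)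
qed

lemma radial_bumps_smooth:
  assumes "f \<in> radial_bumps z0 \<epsilon>"
  shows "smooth_C f"
  using assms
proof (coinduction arbitrary: f)
  case (smooth_C f)
  then obtain f1 f2 where *: "f1 \<in> radial_bumps z0 \<epsilon>" "f2 \<in> radial_bumps z0 \<epsilon>"
    "\<And>z. (f has_derivative (\<lambda>h. f1 z * Re h + f2 z * Im h)) (at z)"
    using radial_bumps_deriv by blast
  have "(\<lambda>z. frechet_derivative f (at z) 1) = f1" "(\<lambda>z. frechet_derivative f (at z) \<i>) = f2"
    using frechet_derivative_at[OF *(3), symmetric] by auto
  then show ?case
    using * by (auto simp: differentiable_def)
qed

text \<open>The support lies in the closed disc of radius \<open>sqrt \<epsilon>\<close> about
  \<open>z0\<close>: \<open>\<epsilon>\<close> is a squared radius, in line with the variable u = |z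
  - z0|^2 used throughout.\<close>

lemma radial_bump_test_function:
  assumes "\<epsilon> > 0"
  shows "test_function (\<lambda>z. bump k (1 - (cmod (z - z0))\<^sup>2 / \<epsilon>))"
proof -
  have "{z. bump k (1 - (cmod (z - z0))\<^sup>2 / \<epsilon>) \<noteq> 0} \<subseteq> cball z0 (sqrt \<epsilon>)"
    using assms by (auto simp: bump_def dist_norm norm_minus_commute field_simps intro!: real_le_rsqrt split: if_splits)
  then have "bounded {z. bump k (1 - (cmod (z - z0))\<^sup>2 / \<epsilon>) \<noteq> 0}"
    using bounded_cball bounded_subset by blast
  then show ?thesis
    using radial_bumps.bump by (auto simp: test_function_def intro: radial_bumps_smooth)
qed

subsection \<open>Circle means\<close>

text \<open>A full turn over {0..1}, so that integrals are means without a factor 1 / (2 pi) and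
  match the parametrisation of \<open>circlepath\<close>.\<close>

abbreviation unit_circle :: "real \<Rightarrow> complex" where
  "unit_circle t \<equiv> exp (2 * of_real pi * \<i> * of_real t)"

text \<open>Cauchy's formula at the centre: the derivative of the circle path cancels the
  denominator of f(u) / u up to the factor 2 pi i.\<close>

lemma circle_mean_holomorphic:
  assumes "f holomorphic_on cball 0 r" "r > 0"
  shows "((\<lambda>t. f (of_real r * unit_circle t)) has_integral f 0) {0..1}"
proof -
  have "((\<lambda>u. f u / (u - 0)) has_contour_integral (2 * of_real pi * \<i> * f 0)) (circlepath 0 r)"
    using assms by (intro Cauchy_integral_circlepath_simple) auto
  then have "((\<lambda>t. f (circlepath 0 r t) / (circlepath 0 r t) *
      vector_derivative (circlepath 0 r) (at t within {0..1})) has_integral (2 * of_real pi * \<i> * f 0)) {0..1}"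
    by (simp add: has_contour_integral_def)
  then have "((\<lambda>t. 2 * of_real pi * \<i> * f (of_real r * unit_circle t)) has_integral (2 * of_real pi * \<i> * f 0)) {0..1}"
    by (rule has_integral_eq[rotated])
       (use assms in \<open>simp add: vector_derivative_circlepath01, simp add: circlepath\<close>)
  moreover have "((\<lambda>t. g t) has_integral y) {0..1}"
    if "((\<lambda>t. c * g t) has_integral c * y) {0..1}" "c \<noteq> 0" for g :: "real \<Rightarrow> complex" and c y
    using has_integral_mult_right[OF that(1), of "inverse c"] that(2) by (simp add: mult.assoc[symmetric])
  ultimately show ?thesis by simp
qed

lemma norm_unit_circle [simp]: "cmod (unit_circle t) = 1"
  by (simp add: norm_exp_eq_Re)

text \<open>For |w| < 1 the values 1 - w z stay in the right half plane on the closed unit disc, so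
  the principal branch \<open>Ln\<close> is holomorphic there; its value at the centre is Ln 1 =
  0.\<close>

lemma circle_mean_ln_norm_1_minus:
  assumes "cmod w < 1"
  shows "((\<lambda>t. ln (cmod (1 - w * unit_circle t))) has_integral 0) {0..1}"
proof -
  have *: "Re (1 - w * z) > 0" if "cmod z \<le> 1" for z
  proof -
    have "Re (w * z) \<le> cmod w * cmod z"
      using complex_Re_le_cmod[of "w * z"] by (simp add: norm_mult)
    also have "\<dots> < 1"
      using assms that by (meson le_less_trans mult_left_le norm_ge_zero)
    finally show ?thesis by simp
  qed
  have "((\<lambda>t. Ln (1 - w * (of_real 1 * unit_circle t))) has_integral Ln (1 - w * 0)) {0..1}"
  proof (rule circle_mean_holomorphic)
    show "(\<lambda>z. Ln (1 - w * z)) holomorphic_on cball 0 1"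
      using * by (intro holomorphic_intros) (force simp: complex_nonpos_Reals_iff)
  qed simp
  from has_integral_linear[OF this bounded_linear_Re]
  have "((\<lambda>t. Re (Ln (1 - w * unit_circle t))) has_integral 0) {0..1}"
    by (simp add: o_def)
  then show ?thesis
  proof (rule has_integral_eq[rotated])
    fix t :: real
    have "1 - w * unit_circle t \<noteq> 0"
      using *[of "unit_circle t"] by (metis less_irrefl norm_unit_circle order_refl zero_complex.simps(1))
    then show "Re (Ln (1 - w * unit_circle t)) = ln (cmod (1 - w * unit_circle t))"
      by (rule Re_Ln)
  qed
qed

text \<open>Factor out the larger of r and |w|; what remains is 1 - v e with |v| < 1 and e on the
  unit circle, whose logarithm has mean 0. For |w| = r the singularity lies on the circle; such
  radii are discarded later as a null set.\<close>

lemma circle_mean_ln_norm_diff: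
  assumes "r > 0" "cmod w \<noteq> r"
  shows "((\<lambda>t. ln (cmod (of_real r * unit_circle t - w))) has_integral ln (max r (cmod w))) {0..1}"
proof (cases "cmod w < r")
  case True
  define v where "v = cnj w / of_real r"
  have v: "cmod v < 1" using True assms by (simp add: v_def norm_divide)
  have neq: "cmod (1 - v * unit_circle t) > 0" for t
    using v norm_triangle_ineq2[of 1 "v * unit_circle t"]
    unfolding norm_mult norm_unit_circle norm_one by linarith
  have eq: "cmod (of_real r * unit_circle t - w) = r * cmod (1 - v * unit_circle t)" for t
  proof -
    have u: "cnj (unit_circle t) * unit_circle t = 1"
      using complex_norm_square[of "unit_circle t"] by (simp only: norm_unit_circle mult.commute) simp
    \<comment> \<open>Conjugation exchanges the small and the large term: on the unit circle the
      conjugate of e is its inverse, so |r e - w| = |r - cnj w * e|.\<close>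
    have "of_real r * (1 - v * unit_circle t) = cnj (of_real r * unit_circle t - w) * unit_circle t"
      using u assms by (simp add: v_def algebra_simps)
    then have "cmod (of_real r * (1 - v * unit_circle t)) = cmod (of_real r * unit_circle t - w)"
      by (simp only: norm_mult complex_mod_cnj norm_unit_circle)
    then show ?thesis using assms by (simp add: norm_mult)
  qed
  have "((\<lambda>t. ln r + ln (cmod (1 - v * unit_circle t))) has_integral (ln r + 0)) {0..1}"
    using has_integral_const_real[of "ln r" 0 1]
    by (intro has_integral_add circle_mean_ln_norm_1_minus v) simp
  then have "((\<lambda>t. ln (cmod (of_real r * unit_circle t - w))) has_integral (ln r + 0)) {0..1}"
    by (rule has_integral_eq[rotated]) (use neq assms in \<open>auto simp: eq ln_mult\<close>)
  then show ?thesis using True by (simp add: max_def)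
next
  case False
  with assms have w: "cmod w > r" by simp
  then have w0: "w \<noteq> 0" using assms by auto
  define v where "v = of_real r / w"
  have v: "cmod v < 1" using w w0 assms by (simp add: v_def norm_divide divide_simps)
  have neq: "cmod (1 - v * unit_circle t) > 0" for t
    using v norm_triangle_ineq2[of 1 "v * unit_circle t"]
    unfolding norm_mult norm_unit_circle norm_one by linarith
  have eq: "cmod (of_real r * unit_circle t - w) = cmod w * cmod (1 - v * unit_circle t)" for t
    unfolding norm_mult[symmetric] using w0
    by (subst norm_minus_commute) (simp add: v_def algebra_simps)
  have "((\<lambda>t. ln (cmod w) + ln (cmod (1 - v * unit_circle t))) has_integral (ln (cmod w) + 0)) {0..1}"
    using has_integral_const_real[of "ln (cmod w)" 0 1]
    by (intro has_integral_add circle_mean_ln_norm_1_minus v) simp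
  then have "((\<lambda>t. ln (cmod (of_real r * unit_circle t - w))) has_integral (ln (cmod w) + 0)) {0..1}"
    by (rule has_integral_eq[rotated]) (use neq w0 in \<open>auto simp: eq ln_mult\<close>)
  then show ?thesis using w by (simp add: max_def)
qed

lemma ln_norm_poly:
  fixes P :: "complex poly"
  assumes "P \<noteq> 0" "poly P z \<noteq> 0"
  shows "ln (cmod (poly P z)) =
    ln (cmod (lead_coeff P)) + (\<Sum>x\<in>{x. poly P x = 0}. real (order x P) * ln (cmod (z - x)))"
proof -
  have fin: "finite {x. poly P x = 0}" using assms poly_roots_finite by blast
  have "cmod (poly P z) = cmod (lead_coeff P) * (\<Prod>x\<in>{x. poly P x = 0}. cmod (z - x) ^ order x P)"
    by (subst complex_poly_decompose[of P, symmetric])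
       (simp add: poly_prod norm_mult norm_power prod_norm[symmetric])
  moreover have "(\<Prod>x\<in>{x. poly P x = 0}. cmod (z - x) ^ order x P) > 0"
    using assms by (intro prod_pos) (auto intro!: zero_less_power)
  moreover have "ln (\<Prod>x\<in>{x. poly P x = 0}. cmod (z - x) ^ order x P) =
      (\<Sum>x\<in>{x. poly P x = 0}. real (order x P) * ln (cmod (z - x)))"
    using assms fin by (subst ln_prod) (auto simp: ln_realpow)
  ultimately show ?thesis using assms by (simp add: ln_mult)
qed

lemma jensen_formula_poly:
  fixes P :: "complex poly"
  assumes "P \<noteq> 0" "r > 0" "\<And>x. poly P x = 0 \<Longrightarrow> cmod (x - z0) \<noteq> r"
  shows "((\<lambda>t. ln (cmod (poly P (z0 + of_real r * unit_circle t)))) has_integral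
    (ln (cmod (lead_coeff P)) + (\<Sum>x\<in>{x. poly P x = 0}. real (order x P) * ln (max r (cmod (x - z0)))))) {0..1}"
proof -
  have fin: "finite {x. poly P x = 0}" using assms poly_roots_finite by blast
  have "((\<lambda>t. ln (cmod (lead_coeff P)) + (\<Sum>x\<in>{x. poly P x = 0}. real (order x P) *
     ln (cmod (of_real r * unit_circle t - (x - z0))))) has_integral
    (ln (cmod (lead_coeff P)) + (\<Sum>x\<in>{x. poly P x = 0}. real (order x P) * ln (max r (cmod (x - z0)))))) {0..1}"
    using assms fin has_integral_const_real[of "ln (cmod (lead_coeff P))" 0 1]
    by (intro has_integral_add has_integral_sum has_integral_mult_right circle_mean_ln_norm_diff) auto
  then show ?thesis
  proof (rule has_integral_eq[rotated])
    fix t :: real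
    have "poly P (z0 + of_real r * unit_circle t) \<noteq> 0"
      using assms(2) assms(3)[of "z0 + of_real r * unit_circle t"] by (auto simp: norm_mult)
    from ln_norm_poly[OF assms(1) this]
    show "ln (cmod (lead_coeff P)) + (\<Sum>x\<in>{x. poly P x = 0}. real (order x P) *
     ln (cmod (of_real r * unit_circle t - (x - z0)))) = ln (cmod (poly P (z0 + of_real r * unit_circle t)))"
      by (simp add: algebra_simps)
  qed
qed

subsection \<open>The radial Laplacian of a bump\<close>

text \<open>With h(u) = bump 0 (1 - u / \<epsilon>) this is (u h')' = h' + u h'', a quarter of the
  planar Laplacian of z |-> h(|z - z0|^2). The indices 2, 3 and 4 come from differentiating
  \<open>bump\<close> twice.\<close>

definition bump_lap :: "real \<Rightarrow> real \<Rightarrow> real" where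
  "bump_lap \<epsilon> u = - bump 2 (1 - u / \<epsilon>) / \<epsilon> + u * (bump 4 (1 - u / \<epsilon>) - 2 * bump 3 (1 - u / \<epsilon>)) / \<epsilon>\<^sup>2"

lemma bump_lap_measurable [measurable]: "bump_lap \<epsilon> \<in> borel_measurable borel"
  unfolding bump_lap_def[abs_def] by measurable

lemma bump_lap_continuous: "continuous_on S (bump_lap \<epsilon>)"
proof -
  have "continuous_on S (\<lambda>u. bump k (1 - u / \<epsilon>))" for k
    by (rule continuous_on_compose2[OF bump_continuous[of UNIV]]) (auto intro!: continuous_intros simp: divide_inverse)
  then show ?thesis
    unfolding bump_lap_def[abs_def] divide_inverse by (intro continuous_intros) (simp_all add: divide_inverse)
qed

lemma bump_profile_deriv:
  assumes "\<epsilon> > 0"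
  shows "((\<lambda>u. bump 0 (1 - u / \<epsilon>)) has_real_derivative - bump 2 (1 - u / \<epsilon>) / \<epsilon>) (at u)"
  using assms by (auto intro!: derivative_eq_intros simp: numeral_2_eq_2)

lemma bump_profile_lap:
  assumes "\<epsilon> > 0"
  shows "((\<lambda>u. u * (- bump 2 (1 - u / \<epsilon>) / \<epsilon>)) has_real_derivative bump_lap \<epsilon> u) (at u)"
  using assms
  by (auto intro!: derivative_eq_intros simp: bump_lap_def eval_nat_numeral field_simps)

text \<open>The scaling \<open>bump_lap \<epsilon> u = bump_lap 1 (u / \<epsilon>) /
  \<epsilon>\<close> makes \<open>Q\<close> independent of \<open>\<epsilon>\<close>, as is needed
  when the bump shrinks.\<close>

lemma bump_lap_bound:
  obtains Q where "Q > 0" "\<And>\<epsilon> u. \<epsilon> > 0 \<Longrightarrow> u \<in> {0..\<epsilon>} \<Longrightarrow> \<bar>bump_lap \<epsilon> u\<bar> \<le> Q / \<epsilon>"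
proof -
  have "compact (bump_lap 1 ` {0..1})"
    by (intro compact_continuous_image bump_lap_continuous compact_Icc)
  then obtain Q where Q: "Q > 0" "\<forall>x\<in>bump_lap 1 ` {0..1}. norm x \<le> Q"
    using compact_imp_bounded bounded_pos by metis
  show ?thesis
  proof (rule that[OF Q(1)])
    fix \<epsilon> u :: real assume *: "\<epsilon> > 0" "u \<in> {0..\<epsilon>}"
    have "bump_lap \<epsilon> u = bump_lap 1 (u / \<epsilon>) / \<epsilon>"
      using * by (simp add: bump_lap_def field_simps power2_eq_square)
    moreover have "\<bar>bump_lap 1 (u / \<epsilon>)\<bar> \<le> Q"
      using Q * by auto
    ultimately show "\<bar>bump_lap \<epsilon> u\<bar> \<le> Q / \<epsilon>"
      using * by (simp add: divide_right_mono abs_divide)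
  qed
qed

text \<open>At 0 the product takes the value 0, which is also its limit. This lets the fundamental
  theorem of calculus run up to the singular endpoint of ln.\<close>

lemma mult_ln_continuous: "continuous_on {0..} (\<lambda>u::real. u * ln u)"
proof (clarsimp simp: continuous_on_eq_continuous_within)
  fix x :: real assume "x \<ge> 0"
  show "continuous (at x within {0..}) (\<lambda>u. u * ln u)"
  proof (cases "x = 0")
    case True
    have "((\<lambda>u::real. u * ln u) \<longlongrightarrow> 0) (at_right 0)"
      by real_asymp
    then show ?thesis
      using True by (simp add: continuous_within at_within_Ici_at_right)
  qed (use \<open>x \<ge> 0\<close> in \<open>auto intro!: continuous_intros\<close>)
qed

lemma ln_set_integrable:
  assumes "\<epsilon> > 0"
  shows "set_integrable lborel {0..\<epsilon>} (\<lambda>u::real. ln u)"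
proof -
  \<comment> \<open>\<open>K\<close> lies above ln on the interval (also at 0, where ln 0 = 0 by
    convention). The integrand \<open>K - ln u\<close> is then nonnegative, so its gauge
    integrability is absolute.\<close>
  define K where "K = \<bar>ln \<epsilon>\<bar>"
  have cont: "continuous_on {0..\<epsilon>} (\<lambda>u::real. (K * u + u) - u * ln u)"
    by (intro continuous_intros continuous_on_subset[OF mult_ln_continuous]) auto
  have "((\<lambda>u::real. K - ln u) has_integral ((K * \<epsilon> + \<epsilon>) - \<epsilon> * ln \<epsilon> - ((K * 0 + 0) - 0 * ln 0))) {0..\<epsilon>}"
    using assms by (intro fundamental_theorem_of_calculus_interior cont)
     (auto intro!: derivative_eq_intros simp: has_real_derivative_iff_has_vector_derivative[symmetric])
  moreover have "K - ln u \<ge> 0" if "u \<in> {0..\<epsilon>}" for u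
  proof (cases "u = 0")
    case False
    then have "ln u \<le> ln \<epsilon>" using that assms by (intro ln_mono) auto
    then show ?thesis by (simp add: K_def)
  qed (simp add: K_def)
  ultimately have "(\<lambda>u. K - ln u) absolutely_integrable_on {0..\<epsilon>}"
    by (intro nonnegative_absolutely_integrable_1) (auto simp: integrable_on_def)
  then have "set_integrable lborel {0..\<epsilon>} (\<lambda>u. K - ln u)"
    unfolding set_integrable_def by (subst (asm) integrable_completion) auto
  moreover have "set_integrable lborel {0..\<epsilon>} (\<lambda>u. K)"
    by (intro borel_integrable_atLeastAtMost') auto
  ultimately have "set_integrable lborel {0..\<epsilon>} (\<lambda>u. K - (K - ln u))"
    by (rule set_integral_diff(1)[rotated])
  then show ?thesis by simp
qed

text \<open>Only v = 0, a root at the centre of the bump, is singular; for v > 0 the integrand is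
  continuous.\<close>

lemma bump_lap_ln_max_integrable:
  assumes "\<epsilon> > 0" "v \<ge> 0"
  shows "set_integrable lborel {0..\<epsilon>} (\<lambda>u. bump_lap \<epsilon> u * ln (max u v))"
proof (cases "v = 0")
  case True
  obtain Q where Q: "Q > 0" "\<And>\<epsilon> u. \<epsilon> > 0 \<Longrightarrow> u \<in> {0..\<epsilon>} \<Longrightarrow> \<bar>bump_lap \<epsilon> u\<bar> \<le> Q / \<epsilon>"
    by (rule bump_lap_bound) blast
  have "set_integrable lborel {0..\<epsilon>} (\<lambda>u. Q / \<epsilon> * ln u)"
    by (intro set_integrable_mult_right ln_set_integrable assms)
  then show ?thesis
  proof (rule set_integrable_bound)
    show "set_borel_measurable lborel {0..\<epsilon>} (\<lambda>u. bump_lap \<epsilon> u * ln (max u v))"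
      unfolding set_borel_measurable_def by measurable
    show "AE u in lborel. u \<in> {0..\<epsilon>} \<longrightarrow> norm (bump_lap \<epsilon> u * ln (max u v)) \<le> norm (Q / \<epsilon> * ln u)"
    proof (intro AE_I2 impI)
      fix u assume "u \<in> {0..\<epsilon>}"
      with Q assms have "\<bar>bump_lap \<epsilon> u\<bar> \<le> Q / \<epsilon>" by blast
      then show "norm (bump_lap \<epsilon> u * ln (max u v)) \<le> norm (Q / \<epsilon> * ln u)"
        using \<open>u \<in> {0..\<epsilon>}\<close> True Q(1) assms(1) mult_right_mono[of _ "Q / \<epsilon>" "\<bar>ln u\<bar>"]
        by (auto simp: abs_mult)
    qed
  qed
next
  case False
  then show ?thesis
    using assms by (intro borel_integrable_atLeastAtMost' continuous_intros bump_lap_continuous) auto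
qed

lemma bump_lap_integral:
  assumes "\<epsilon> > 0" "v \<ge> 0"
  shows "(bump_lap \<epsilon> has_integral v * (- bump 2 (1 - v / \<epsilon>) / \<epsilon>)) {0..v}"
  using fundamental_theorem_of_calculus[of 0 v "\<lambda>u. u * (- bump 2 (1 - u / \<epsilon>) / \<epsilon>)" "bump_lap \<epsilon>"] assms
    DERIV_subset[OF bump_profile_lap[OF assms(1)]]
  by (auto simp: has_real_derivative_iff_has_vector_derivative)

text \<open>In the variable \<open>u = |z|\<^sup>2\<close> the function \<open>ln max u v\<close> is the fundamental solution of
  \<open>d/du (u d/du)\<close>, a quarter of the radial Laplacian.\<close>

lemma bump_lap_ln_max:
  assumes "\<epsilon> > 0" "v \<ge> 0"
  shows "((\<lambda>u. bump_lap \<epsilon> u * ln (max u v)) has_integral bump 0 (1 - v / \<epsilon>)) {0..\<epsilon>}"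
proof (cases "v \<le> \<epsilon>")
  case False
  have "((\<lambda>u. bump_lap \<epsilon> u * ln v) has_integral \<epsilon> * (- bump 2 (1 - \<epsilon> / \<epsilon>) / \<epsilon>) * ln v) {0..\<epsilon>}"
    using assms by (intro has_integral_mult_left bump_lap_integral) auto
  then have "((\<lambda>u. bump_lap \<epsilon> u * ln (max u v)) has_integral \<epsilon> * (- bump 2 (1 - \<epsilon> / \<epsilon>) / \<epsilon>) * ln v) {0..\<epsilon>}"
    by (rule has_integral_eq[rotated]) (use False in \<open>auto simp: max_def\<close>)
  moreover have "bump 0 (1 - v / \<epsilon>) = 0"
    using False assms by (auto intro!: bump_eq_0 simp: field_simps)
  ultimately show ?thesis
    using assms by (simp add: bump_eq_0)
next
  case True
  define h where "h = (\<lambda>u. bump 0 (1 - u / \<epsilon>))"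
  define h1 where "h1 = (\<lambda>u. - bump 2 (1 - u / \<epsilon>) / \<epsilon>)"
  have lap: "((\<lambda>u. u * h1 u) has_real_derivative bump_lap \<epsilon> u) (at u)" for u
    unfolding h1_def by (rule bump_profile_lap[OF assms(1)])
  have der: "(h has_real_derivative h1 u) (at u)" for u
    unfolding h_def h1_def by (rule bump_profile_deriv[OF assms(1)])
  \<comment> \<open>Below v the logarithm is constant and leaves the boundary term v h'(v) ln v.
    Above v the primitive u h' ln u - h leaves h v minus the same term, so the sum is h v.\<close>
  have "((\<lambda>u. bump_lap \<epsilon> u * ln v) has_integral v * h1 v * ln v) {0..v}"
    using assms unfolding h1_def by (intro has_integral_mult_left bump_lap_integral) auto
  then have 1: "((\<lambda>u. bump_lap \<epsilon> u * ln (max u v)) has_integral v * h1 v * ln v) {0..v}"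
    by (rule has_integral_eq[rotated]) (auto simp: max_def)
  have h1_cont: "continuous_on {v..\<epsilon>} h1" and h_cont: "continuous_on {v..\<epsilon>} h"
    using assms unfolding h1_def h_def
    by (auto intro!: continuous_intros continuous_on_compose2[OF bump_continuous[of UNIV]])
  \<comment> \<open>Grouping \<open>u * ln u\<close> gives continuity up to the endpoint u = 0,
    which occurs when v = 0.\<close>
  have "continuous_on {v..\<epsilon>} (\<lambda>u. (u * ln u) * h1 u - h u)"
    using assms by (intro continuous_intros h1_cont h_cont continuous_on_subset[OF mult_ln_continuous]) auto
  then have "((\<lambda>u. bump_lap \<epsilon> u * ln u) has_integral (((\<epsilon> * ln \<epsilon>) * h1 \<epsilon> - h \<epsilon>) - ((v * ln v) * h1 v - h v))) {v..\<epsilon>}"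
  proof (intro fundamental_theorem_of_calculus_interior True)
    fix u assume u: "u \<in> {v<..<\<epsilon>}"
    have "((\<lambda>u. (u * h1 u) * ln u - h u) has_real_derivative bump_lap \<epsilon> u * ln u) (at u)"
      using u assms
      by (intro DERIV_cong[OF DERIV_diff[OF DERIV_mult[OF lap DERIV_ln] der]]) auto
    then show "((\<lambda>u. (u * ln u) * h1 u - h u) has_vector_derivative bump_lap \<epsilon> u * ln u) (at u)"
      by (simp add: has_real_derivative_iff_has_vector_derivative mult_ac)
  qed
  moreover have "h \<epsilon> = 0" "h1 \<epsilon> = 0"
    using assms by (auto simp: h_def h1_def bump_eq_0)
  ultimately have "((\<lambda>u. bump_lap \<epsilon> u * ln u) has_integral (h v - v * h1 v * ln v)) {v..\<epsilon>}"
    by (simp add: mult_ac)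
  then have 2: "((\<lambda>u. bump_lap \<epsilon> u * ln (max u v)) has_integral (h v - v * h1 v * ln v)) {v..\<epsilon>}"
    by (rule has_integral_eq[rotated]) (auto simp: max_def)
  from has_integral_combine[OF assms(2) True 1 2]
  show ?thesis by (simp add: h_def)
qed

text \<open>Annihilates additive constants: the leading coefficient in Jensen's formula, and later
  the constant term of the Taylor expansion.\<close>

lemma bump_lap_integral_0:
  assumes "\<epsilon> > 0"
  shows "(bump_lap \<epsilon> has_integral 0) {0..\<epsilon>}"
  using bump_lap_integral[OF assms, of \<epsilon>] assms by (simp add: bump_eq_0)

text \<open>The integrand is the derivative of u^2 h' - u h, which vanishes at both ends. It
  identifies the first moment of \<open>bump_lap\<close> with the mass of the bump without
  evaluating either.\<close>

lemma bump_lap_integral_id: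
  assumes "\<epsilon> > 0"
  shows "((\<lambda>u. u * bump_lap \<epsilon> u - bump 0 (1 - u / \<epsilon>)) has_integral 0) {0..\<epsilon>}"
proof -
  define h where "h = (\<lambda>u. bump 0 (1 - u / \<epsilon>))"
  define h1 where "h1 = (\<lambda>u. - bump 2 (1 - u / \<epsilon>) / \<epsilon>)"
  have lap: "((\<lambda>u. u * h1 u) has_real_derivative bump_lap \<epsilon> u) (at u)" for u
    unfolding h1_def by (rule bump_profile_lap[OF assms(1)])
  have der: "(h has_real_derivative h1 u) (at u)" for u
    unfolding h_def h1_def by (rule bump_profile_deriv[OF assms(1)])
  have "((\<lambda>u. u * (u * h1 u) - u * h u) has_real_derivative (u * bump_lap \<epsilon> u - h u)) (at u)" for u
    by (rule DERIV_cong[OF DERIV_diff[OF DERIV_mult[OF DERIV_ident lap] DERIV_mult[OF DERIV_ident der]]])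
       (simp add: algebra_simps)
  then have "((\<lambda>u. u * bump_lap \<epsilon> u - h u) has_integral ((\<epsilon> * (\<epsilon> * h1 \<epsilon>) - \<epsilon> * h \<epsilon>) - (0 * (0 * h1 0) - 0 * h 0))) {0..\<epsilon>}"
    using assms by (intro fundamental_theorem_of_calculus)
     (auto simp: has_real_derivative_iff_has_vector_derivative[symmetric] intro: DERIV_subset)
  moreover have "h \<epsilon> = 0" "h1 \<epsilon> = 0"
    using assms by (auto simp: h_def h1_def bump_eq_0)
  ultimately show ?thesis by (simp add: h_def)
qed

subsection \<open>Smoothed zero counting\<close>

text \<open>Restricting the measure, rather than putting an indicator into the integrand, turns the
  ranges of radius and angle into finite measures to which the product-measure theorems
  apply.\<close>

abbreviation lborel_Icc :: "real \<Rightarrow> real \<Rightarrow> real measure" where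
  "lborel_Icc a b \<equiv> restrict_space lborel {a..b}"

lemma finite_measure_lborel_Icc: "finite_measure (lborel_Icc a b)"
  by (rule finite_measureI) (simp add: emeasure_restrict_space space_restrict_space emeasure_lborel_Icc_eq)

lemma integrable_lborel_Icc:
  "integrable (lborel_Icc a b) f \<longleftrightarrow> set_integrable lborel {a..b} f"
  for f :: "real \<Rightarrow> real"
  by (simp add: integrable_restrict_space set_integrable_def)

lemma integral_lborel_Icc:
  fixes f :: "real \<Rightarrow> real"
  assumes "set_integrable lborel {a..b} f" "(f has_integral I) {a..b}"
  shows "integral\<^sup>L (lborel_Icc a b) f = I"
proof -
  have "integral\<^sup>L (lborel_Icc a b) f = (LINT x:{a..b}|lborel. f x)"
    by (simp add: integral_restrict_space set_lebesgue_integral_def)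
  also have "\<dots> = integral {a..b} f"
    by (rule set_borel_integral_eq_integral(2)[OF assms(1)])
  finally show ?thesis using assms(2) by (simp add: integral_unique)
qed

lemma measurable_id_lborel_Icc: "(\<lambda>x. x) \<in> borel_measurable (lborel_Icc a b)"
  by (rule measurable_restrict_space1) simp

lemma measurable_lborel_Icc_borel:
  "f \<in> borel_measurable borel \<Longrightarrow> f \<in> borel_measurable (lborel_Icc a b)"
  by (rule measurable_restrict_space1) simp

lemma fst_measurable_lborel_Icc: "fst \<in> borel_measurable (lborel_Icc a b \<Otimes>\<^sub>M K)"
  by (rule measurable_compose[OF measurable_fst measurable_id_lborel_Icc])

lemma snd_measurable_lborel_Icc: "snd \<in> borel_measurable (K \<Otimes>\<^sub>M lborel_Icc a b)"
  by (rule measurable_compose[OF measurable_snd measurable_id_lborel_Icc])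

lemma poly_measurable [measurable]: "poly (P :: complex poly) \<in> borel_measurable borel"
  by (intro borel_measurable_continuous_onI continuous_intros)

text \<open>This holds for every nonzero polynomial, not just almost surely, which is what makes the random
  variable \<open>zero_sum\<close> measurable; otherwise its Bochner integral would be the junk value 0.\<close>

lemma zero_sum_bump:
  fixes P :: "complex poly"
  assumes "P \<noteq> 0" "\<epsilon> > 0"
  shows "zero_sum P (\<lambda>z. bump 0 (1 - (cmod (z - z0))\<^sup>2 / \<epsilon>)) =
    (\<integral>u. (\<integral>t. bump_lap \<epsilon> u * (2 * ln (cmod (poly P (z0 + of_real (sqrt u) * unit_circle t)))) \<partial>lborel_Icc 0 1) \<partial>lborel_Icc 0 \<epsilon>)"
proof -
  interpret T: finite_measure "lborel_Icc 0 1" by (rule finite_measure_lborel_Icc)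
  define Z where "Z = {x. poly P x = 0}"
  have fin: "finite Z" using assms poly_roots_finite by (auto simp: Z_def)
  define F where "F = (\<lambda>u. bump_lap \<epsilon> u * (2 * ln (cmod (lead_coeff P))) +
     (\<Sum>x\<in>Z. real (order x P) * (bump_lap \<epsilon> u * ln (max u ((cmod (x - z0))\<^sup>2)))))"
  have inner: "(\<integral>t. bump_lap \<epsilon> u * (2 * ln (cmod (poly P (z0 + of_real (sqrt u) * unit_circle t)))) \<partial>lborel_Icc 0 1) = F u"
    if u: "u > 0" "u \<notin> (\<lambda>x. (cmod (x - z0))\<^sup>2) ` Z" for u
  proof (rule integral_lborel_Icc)
    have ne: "cmod (x - z0) \<noteq> sqrt u" if "poly P x = 0" for x
    proof
      assume "cmod (x - z0) = sqrt u"
      then have "u = (cmod (x - z0))\<^sup>2" using u by simp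
      then show False using u(2) that by (auto simp: Z_def)
    qed
    have "poly P (z0 + of_real (sqrt u) * unit_circle t) \<noteq> 0" for t
      using u(1) ne[of "z0 + of_real (sqrt u) * unit_circle t"] by (auto simp: norm_mult)
    then show "set_integrable lborel {0..1} (\<lambda>t. bump_lap \<epsilon> u * (2 * ln (cmod (poly P (z0 + of_real (sqrt u) * unit_circle t)))))"
      by (intro borel_integrable_atLeastAtMost' continuous_intros) auto
    have "((\<lambda>t. bump_lap \<epsilon> u * (2 * ln (cmod (poly P (z0 + of_real (sqrt u) * unit_circle t))))) has_integral
      bump_lap \<epsilon> u * (2 * (ln (cmod (lead_coeff P)) + (\<Sum>x\<in>Z. real (order x P) * ln (max (sqrt u) (cmod (x - z0))))))) {0..1}"
      unfolding Z_def using u ne assms by (intro has_integral_mult_right jensen_formula_poly) auto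
    \<comment> \<open>The factor 2 passes from the radius to the squared radius, in which
      \<open>ln (max u v)\<close> is the fundamental solution.\<close>
    moreover have max_eq: "2 * ln (max (sqrt u) (cmod (x - z0))) = ln (max u ((cmod (x - z0))\<^sup>2))" for x
    proof -
      have "max u ((cmod (x - z0))\<^sup>2) = (max (sqrt u) (cmod (x - z0)))\<^sup>2"
        using u by (auto simp: max_def real_le_lsqrt sqrt_le_D real_sqrt_le_iff
            intro: order_antisym real_le_rsqrt)
      moreover have "max (sqrt u) (cmod (x - z0)) > 0" using u by (simp add: less_max_iff_disj)
      ultimately show ?thesis by (simp add: ln_realpow)
    qed
    have "bump_lap \<epsilon> u * (2 * (ln (cmod (lead_coeff P)) + (\<Sum>x\<in>Z. real (order x P) * ln (max (sqrt u) (cmod (x - z0)))))) = F u"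
      unfolding F_def max_eq[symmetric] by (simp add: algebra_simps sum_distrib_left sum_distrib_right)
    ultimately show "((\<lambda>t. bump_lap \<epsilon> u * (2 * ln (cmod (poly P (z0 + of_real (sqrt u) * unit_circle t))))) has_integral F u) {0..1}"
      by simp
  qed
  have "(\<integral>u. (\<integral>t. bump_lap \<epsilon> u * (2 * ln (cmod (poly P (z0 + of_real (sqrt u) * unit_circle t)))) \<partial>lborel_Icc 0 1) \<partial>lborel_Icc 0 \<epsilon>)
     = (\<integral>u. F u \<partial>lborel_Icc 0 \<epsilon>)"
  proof (rule integral_cong_AE)
    note [measurable] = measurable_id_lborel_Icc fst_measurable_lborel_Icc snd_measurable_lborel_Icc
    show "(\<lambda>u. \<integral>t. bump_lap \<epsilon> u * (2 * ln (cmod (poly P (z0 + of_real (sqrt u) * unit_circle t)))) \<partial>lborel_Icc 0 1) \<in> borel_measurable (lborel_Icc 0 \<epsilon>)"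
      by measurable
    show "F \<in> borel_measurable (lborel_Icc 0 \<epsilon>)"
      unfolding F_def by (rule measurable_lborel_Icc_borel) measurable
    \<comment> \<open>Circles through a root, and the degenerate radius 0, give finitely many
      exceptional values of \<open>u\<close>.\<close>
    have "finite (insert 0 ((\<lambda>x. (cmod (x - z0))\<^sup>2) ` Z))" using fin by simp
    then have "AE u in lborel. u \<notin> insert 0 ((\<lambda>x. (cmod (x - z0))\<^sup>2) ` Z)"
      by (intro AE_not_in finite_imp_null_set_lborel)
    then have "AE u in lborel. u \<in> {0..\<epsilon>} \<longrightarrow> (\<integral>t. bump_lap \<epsilon> u * (2 * ln (cmod (poly P (z0 + of_real (sqrt u) * unit_circle t)))) \<partial>lborel_Icc 0 1) = F u"
      by eventually_elim (use inner in auto)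
    then show "AE u in lborel_Icc 0 \<epsilon>. (\<integral>t. bump_lap \<epsilon> u * (2 * ln (cmod (poly P (z0 + of_real (sqrt u) * unit_circle t)))) \<partial>lborel_Icc 0 1) = F u"
      by (subst AE_restrict_space_iff) auto
  qed
  also have "\<dots> = zero_sum P (\<lambda>z. bump 0 (1 - (cmod (z - z0))\<^sup>2 / \<epsilon>))"
  proof (rule integral_lborel_Icc)
    show "set_integrable lborel {0..\<epsilon>} F"
    proof -
      have "set_integrable lborel {0..\<epsilon>} (bump_lap \<epsilon>)"
        by (intro borel_integrable_atLeastAtMost' bump_lap_continuous)
      moreover have "set_integrable lborel {0..\<epsilon>} (\<lambda>u. bump_lap \<epsilon> u * ln (max u ((cmod (x - z0))\<^sup>2)))" for x
        using assms by (intro bump_lap_ln_max_integrable) auto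
      ultimately show ?thesis
        unfolding F_def integrable_lborel_Icc[symmetric]
        by (intro Bochner_Integration.integrable_add integrable_mult_left integrable_mult_right
            Bochner_Integration.integrable_sum) auto
    qed
    have "(F has_integral 0 * (2 * ln (cmod (lead_coeff P))) +
       (\<Sum>x\<in>Z. real (order x P) * bump 0 (1 - (cmod (x - z0))\<^sup>2 / \<epsilon>))) {0..\<epsilon>}"
      unfolding F_def using fin assms
      by (intro has_integral_add has_integral_mult_left bump_lap_integral_0 has_integral_sum
          has_integral_mult_right bump_lap_ln_max) auto
    then show "(F has_integral zero_sum P (\<lambda>z. bump 0 (1 - (cmod (z - z0))\<^sup>2 / \<epsilon>))) {0..\<epsilon>}"
      by (simp add: zero_sum_def Z_def)
  qed
  finally show ?thesis ..
qed

subsection \<open>Complex Gaussian variables\<close>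

lemma nn_integral_lborel_translate:
  fixes f :: "'a::euclidean_space \<Rightarrow> ennreal"
  assumes [measurable]: "f \<in> borel_measurable borel"
  shows "(\<integral>\<^sup>+x. f (c + x) \<partial>lborel) = (\<integral>\<^sup>+x. f x \<partial>lborel)"
  by (subst (2) lborel_distr_plus[of c, symmetric]) (simp add: nn_integral_distr)

lemma emeasure_lborel_complex_ball:
  "r \<ge> 0 \<Longrightarrow> emeasure lborel (ball (c::complex) r) = ennreal (pi * r\<^sup>2)"
  "r \<ge> 0 \<Longrightarrow> emeasure lborel (cball (c::complex) r) = ennreal (pi * r\<^sup>2)"
  by (simp_all add: emeasure_ball emeasure_cball unit_ball_vol_2)

text \<open>Multiplication by a complex number is handled by the uniqueness argument for Haar measure,
  testing both translation invariant measures against a ball.\<close>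

lemma lborel_distr_mult_complex:
  fixes \<alpha> :: complex
  assumes "\<alpha> \<noteq> 0"
  shows "distr lborel borel ((*) \<alpha>) = density lborel (\<lambda>_. ennreal (1 / (cmod \<alpha>)\<^sup>2))"
proof (rule measure_eqI)
  fix A assume "A \<in> sets (distr lborel borel ((*) \<alpha>))"
  then have [measurable]: "A \<in> sets borel" by simp
  let ?I = "indicator :: complex set \<Rightarrow> complex \<Rightarrow> ennreal"
  let ?B = "ball (0::complex) 1"
  have [measurable]: "?B \<in> sets borel" by simp
  have "emeasure lborel A * ennreal (pi / (cmod \<alpha>)\<^sup>2) = (\<integral>\<^sup>+x. ?I A x \<partial>lborel) * (\<integral>\<^sup>+y. ?I ?B (\<alpha> * y) \<partial>lborel)"
  proof -
    have "(\<integral>\<^sup>+y. ?I ?B (\<alpha> * y) \<partial>lborel) = (\<integral>\<^sup>+y. ?I (ball 0 (1 / cmod \<alpha>)) y \<partial>lborel)"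
      using assms by (intro nn_integral_cong) (auto simp: indicator_def norm_mult field_simps)
    also have "\<dots> = ennreal (pi / (cmod \<alpha>)\<^sup>2)"
      by (simp add: emeasure_lborel_complex_ball power_divide)
    finally show ?thesis by simp
  qed
  also have "\<dots> = (\<integral>\<^sup>+y. (\<integral>\<^sup>+x. ?I A x \<partial>lborel) * ?I ?B (\<alpha> * y) \<partial>lborel)"
    by (rule nn_integral_cmult[symmetric]) measurable
  also have "\<dots> = (\<integral>\<^sup>+y. (\<integral>\<^sup>+x. ?I A x * ?I ?B (\<alpha> * y) \<partial>lborel) \<partial>lborel)"
    by (intro nn_integral_cong nn_integral_multc[symmetric]) measurable
  \<comment> \<open>Shifting x by \<alpha> y moves both arguments along with y. After Fubini,
    shifting y by - x / \<alpha> frees A from x, so that the remaining x-integral is the area of a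
    unit disc.\<close>
  also have "\<dots> = (\<integral>\<^sup>+y. (\<integral>\<^sup>+x. ?I A (\<alpha> * y + x) * ?I ?B (\<alpha> * y) \<partial>lborel) \<partial>lborel)"
    by (intro nn_integral_cong nn_integral_lborel_translate[symmetric]) measurable
  also have "\<dots> = (\<integral>\<^sup>+x. (\<integral>\<^sup>+y. ?I A (\<alpha> * y + x) * ?I ?B (\<alpha> * y) \<partial>lborel) \<partial>lborel)"
    by (rule lborel_pair.Fubini') measurable
  also have "\<dots> = (\<integral>\<^sup>+x. (\<integral>\<^sup>+y. ?I A (\<alpha> * (- x / \<alpha> + y) + x) * ?I ?B (\<alpha> * (- x / \<alpha> + y)) \<partial>lborel) \<partial>lborel)"
    by (intro nn_integral_cong nn_integral_lborel_translate[symmetric]) measurable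
  also have "\<dots> = (\<integral>\<^sup>+x. (\<integral>\<^sup>+y. ?I A (\<alpha> * y) * ?I ?B (\<alpha> * y - x) \<partial>lborel) \<partial>lborel)"
    using assms by (simp add: algebra_simps)
  also have "\<dots> = (\<integral>\<^sup>+y. (\<integral>\<^sup>+x. ?I A (\<alpha> * y) * ?I ?B (\<alpha> * y - x) \<partial>lborel) \<partial>lborel)"
    by (rule lborel_pair.Fubini') measurable
  also have "\<dots> = (\<integral>\<^sup>+y. (\<integral>\<^sup>+x. ?I A (\<alpha> * y) * ?I (ball (\<alpha> * y) 1) x \<partial>lborel) \<partial>lborel)"
    by (intro nn_integral_cong) (auto simp: indicator_def dist_norm norm_minus_commute)
  also have "\<dots> = (\<integral>\<^sup>+y. ?I A (\<alpha> * y) * ennreal pi \<partial>lborel)"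
    by (intro nn_integral_cong) (simp add: nn_integral_cmult_indicator emeasure_lborel_complex_ball)
  also have "\<dots> = (\<integral>\<^sup>+y. ?I A (\<alpha> * y) \<partial>lborel) * ennreal pi"
    by (rule nn_integral_multc) measurable
  also have "(\<integral>\<^sup>+y. ?I A (\<alpha> * y) \<partial>lborel) = emeasure (distr lborel borel ((*) \<alpha>)) A"
    using nn_integral_distr[of "(*) \<alpha>" lborel borel "?I A"] by simp
  finally have eq: "emeasure lborel A * ennreal (pi / (cmod \<alpha>)\<^sup>2) = emeasure (distr lborel borel ((*) \<alpha>)) A * ennreal pi" .
  have "emeasure (distr lborel borel ((*) \<alpha>)) A = emeasure (distr lborel borel ((*) \<alpha>)) A * (ennreal pi * ennreal (1 / pi))"
    by (simp add: ennreal_mult[symmetric])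
  also have "\<dots> = emeasure lborel A * (ennreal (pi / (cmod \<alpha>)\<^sup>2) * ennreal (1 / pi))"
    using eq by (simp add: mult.assoc[symmetric])
  also have "ennreal (pi / (cmod \<alpha>)\<^sup>2) * ennreal (1 / pi) = ennreal (1 / (cmod \<alpha>)\<^sup>2)"
    by (simp add: ennreal_mult[symmetric])
  finally show "emeasure (distr lborel borel ((*) \<alpha>)) A = emeasure (density lborel (\<lambda>_. ennreal (1 / (cmod \<alpha>)\<^sup>2))) A"
    by (simp add: emeasure_density nn_integral_cmult_indicator mult.commute[of "emeasure lborel A"])
qed simp

text \<open>Polar coordinates with the angle integrated out: a disc of squared radius t has area pi
  t, and half-lines generate the Borel sets.\<close>

lemma lborel_distr_norm_square:
  "distr lborel borel (\<lambda>z::complex. (cmod (z - c))\<^sup>2) = density lborel (\<lambda>u. ennreal pi * indicator {0..} u)"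
proof (rule measure_eqI_generator_eq[where E = "range (\<lambda>a. {..a::real})" and \<Omega> = UNIV and A = "\<lambda>i. {..real i}"])
  show "Int_stable (range (\<lambda>a. {..a::real}))"
    by (auto simp: Int_stable_def)
  have sets: "sets borel = sigma_sets UNIV (range (\<lambda>a. {..a::real}))"
    by (subst borel_eq_atMost) simp
  show "sets (distr lborel borel (\<lambda>z. (cmod (z - c))\<^sup>2)) = sigma_sets UNIV (range (\<lambda>a. {..a::real}))"
    "sets (density lborel (\<lambda>u. ennreal pi * indicator {0..} u)) = sigma_sets UNIV (range (\<lambda>a. {..a::real}))"
    by (simp_all add: sets)
  have *: "emeasure (distr lborel borel (\<lambda>z. (cmod (z - c))\<^sup>2)) {..t} = ennreal (pi * max 0 t)" for t
  proof -
    have "emeasure (distr lborel borel (\<lambda>z. (cmod (z - c))\<^sup>2)) {..t} = emeasure lborel ((\<lambda>z. (cmod (z - c))\<^sup>2) -` {..t})"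
      by (subst emeasure_distr) auto
    also have "\<dots> = ennreal (pi * max 0 t)"
    proof (cases "t \<ge> 0")
      case True
      have "(\<lambda>z. (cmod (z - c))\<^sup>2) -` {..t} = cball c (sqrt t)"
        using True by (auto simp: dist_norm norm_minus_commute intro: real_le_rsqrt dest: sqrt_ge_absD real_le_lsqrt)
          (metis norm_ge_zero power2_le_imp_le real_sqrt_ge_zero real_sqrt_pow2 power_mono)
      then show ?thesis using True by (simp add: emeasure_lborel_complex_ball)
    next
      case False
      then have "(\<lambda>z. (cmod (z - c))\<^sup>2) -` {..t} = {}"
        by (auto simp: not_le) (meson zero_le_power2 less_le_trans not_le)
      then show ?thesis using False by simp
    qed
    finally show ?thesis .
  qed
  show "emeasure (distr lborel borel (\<lambda>z. (cmod (z - c))\<^sup>2)) {..real i} \<noteq> \<infinity>" for i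
    by (simp add: *)
  show "emeasure (distr lborel borel (\<lambda>z. (cmod (z - c))\<^sup>2)) X = emeasure (density lborel (\<lambda>u. ennreal pi * indicator {0..} u)) X"
    if "X \<in> range (\<lambda>a. {..a::real})" for X
  proof -
    from that obtain t where X: "X = {..t}" by auto
    have "emeasure (density lborel (\<lambda>u. ennreal pi * indicator {0..} u)) X = (\<integral>\<^sup>+u. ennreal pi * indicator {0..t} u \<partial>lborel)"
      unfolding X by (subst emeasure_density) (auto intro!: nn_integral_cong simp: indicator_def)
    also have "\<dots> = ennreal (pi * max 0 t)"
      by (simp add: nn_integral_cmult emeasure_lborel_Icc_eq ennreal_mult max_def)
    finally show ?thesis by (simp add: X *)
  qed
  show "(\<Union>i. {..real i}) = UNIV"
    by (auto simp: real_arch_simple)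
qed auto

lemma nn_integral_radial:
  fixes f :: "real \<Rightarrow> ennreal"
  assumes [measurable]: "f \<in> borel_measurable borel"
  shows "(\<integral>\<^sup>+z. f ((cmod (z - c))\<^sup>2) \<partial>lborel) = ennreal pi * (\<integral>\<^sup>+u. f u * indicator {0..} u \<partial>lborel)"
proof -
  have "(\<integral>\<^sup>+z. f ((cmod (z - c))\<^sup>2) \<partial>lborel) = (\<integral>\<^sup>+u. f u \<partial>distr lborel borel (\<lambda>z::complex. (cmod (z - c))\<^sup>2))"
    by (simp add: nn_integral_distr)
  also have "\<dots> = (\<integral>\<^sup>+u. ennreal pi * (f u * indicator {0..} u) \<partial>lborel)"
    unfolding lborel_distr_norm_square by (simp add: nn_integral_density mult_ac)
  also have "\<dots> = ennreal pi * (\<integral>\<^sup>+u. f u * indicator {0..} u \<partial>lborel)"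
    by (rule nn_integral_cmult) measurable
  finally show ?thesis .
qed

section \<open>Complex Gaussian densities with E |z|^2 = s: convolution, scaling and sums\<close>

definition cgauss :: "real \<Rightarrow> complex \<Rightarrow> real" where
  "cgauss s z = exp (- ((cmod z)\<^sup>2 / s)) / (pi * s)"

lemma cgauss_1: "cgauss 1 = std_cgauss_density"
  by (simp add: cgauss_def std_cgauss_density_def fun_eq_iff)

lemma cgauss_measurable [measurable]: "cgauss s \<in> borel_measurable borel"
  unfolding cgauss_def by measurable

lemma nn_integral_exp_decay:
  assumes "s > 0"
  shows "(\<integral>\<^sup>+u. ennreal (exp (- (u / s))) * indicator {0..} u \<partial>lborel) = ennreal s"
proof -
  have "((\<lambda>u. - s * exp (- (u / s))) \<longlongrightarrow> 0) at_top"
    using assms by real_asymp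
  then have "(\<integral>\<^sup>+u. ennreal (exp (- (u / s))) * indicator {0..} u \<partial>lborel) = ennreal (0 - (- s * exp (- (0 / s))))"
    using assms by (intro nn_integral_FTC_atLeast) (auto intro!: derivative_eq_intros)
  then show ?thesis by simp
qed

lemma nn_integral_cgauss:
  assumes "s > 0"
  shows "(\<integral>\<^sup>+z. ennreal (cgauss s (z - c)) \<partial>lborel) = 1"
proof -
  have "(\<integral>\<^sup>+z. ennreal (cgauss s (z - c)) \<partial>lborel) =
      ennreal pi * (\<integral>\<^sup>+u. ennreal (exp (- (u / s)) / (pi * s)) * indicator {0..} u \<partial>lborel)"
    unfolding cgauss_def by (rule nn_integral_radial) measurable
  also have "(\<integral>\<^sup>+u. ennreal (exp (- (u / s)) / (pi * s)) * indicator {0..} u \<partial>lborel) =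
     (\<integral>\<^sup>+u. ennreal (1 / (pi * s)) * (ennreal (exp (- (u / s))) * indicator {0..} u) \<partial>lborel)"
    using assms by (intro nn_integral_cong) (auto simp: ennreal_mult[symmetric] indicator_def)
  also have "\<dots> = ennreal (1 / (pi * s)) * ennreal s"
    using assms by (subst nn_integral_cmult) (auto simp: nn_integral_exp_decay)
  also have "ennreal pi * \<dots> = 1"
    using assms by (simp add: ennreal_mult[symmetric])
  finally show ?thesis .
qed

text \<open>Completing the square. Given the sum w of independent Gaussians of variances s and t,
  the first summand is Gaussian with mean s w / (s + t) and variance s t / (s + t).\<close>

lemma cgauss_convolution:
  assumes "s > 0" "t > 0"
  shows "cgauss t (w - x) * cgauss s x = cgauss (s + t) w * cgauss (s * t / (s + t)) (x - of_real (s / (s + t)) * w)"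
proof -
  have 1: "(cmod (x - of_real (s / (s + t)) * w))\<^sup>2 = (cmod x)\<^sup>2 - 2 * (s / (s + t)) * Re (x * cnj w) + (s / (s + t))\<^sup>2 * (cmod w)\<^sup>2"
    by (simp only: cmod_power2) (simp add: power2_eq_square algebra_simps add_divide_distrib)
  have 2: "(cmod (w - x))\<^sup>2 = (cmod w)\<^sup>2 - 2 * Re (x * cnj w) + (cmod x)\<^sup>2"
    by (simp only: cmod_power2) (simp add: power2_eq_square algebra_simps)
  have "- ((cmod (w - x))\<^sup>2 / t) + - ((cmod x)\<^sup>2 / s) = - ((cmod w)\<^sup>2 / (s + t)) +
     - ((cmod (x - of_real (s / (s + t)) * w))\<^sup>2 / (s * t / (s + t)))"
    unfolding 1 2 using assms by (simp add: divide_simps add_pos_pos) (simp add: algebra_simps power2_eq_square)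
  then have "exp (- ((cmod (w - x))\<^sup>2 / t)) * exp (- ((cmod x)\<^sup>2 / s)) = exp (- ((cmod w)\<^sup>2 / (s + t))) *
     exp (- ((cmod (x - of_real (s / (s + t)) * w))\<^sup>2 / (s * t / (s + t))))"
    by (simp only: exp_add[symmetric])
  moreover have "(pi * t) * (pi * s) = (pi * (s + t)) * (pi * (s * t / (s + t)))"
    using assms by (simp add: field_simps)
  ultimately show ?thesis
    unfolding cgauss_def times_divide_times_eq by simp
qed

lemma cgauss_nonneg: "s > 0 \<Longrightarrow> cgauss s z \<ge> 0"
  by (simp add: cgauss_def)

text \<open>After the substitution w = x + y, \<open>cgauss_convolution\<close> leaves a single
  shifted Gaussian in x, whose integral is 1.\<close>

lemma (in prob_space) cgauss_add:
  assumes indep: "indep_var borel X borel Y" and "s > 0" "t > 0"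
    and X: "distr M borel X = density lborel (\<lambda>z. ennreal (cgauss s z))"
    and Y: "distr M borel Y = density lborel (\<lambda>z. ennreal (cgauss t z))"
  shows "distr M borel (\<lambda>\<omega>. X \<omega> + Y \<omega>) = density lborel (\<lambda>z. ennreal (cgauss (s + t) z))"
proof (rule measure_eqI)
  have [measurable]: "X \<in> borel_measurable M" "Y \<in> borel_measurable M"
    using indep by (blast dest: indep_var_rv1 indep_var_rv2)+
  let ?s = "\<lambda>z. ennreal (cgauss s z)" and ?t = "\<lambda>z. ennreal (cgauss t z)"
  interpret Y: prob_space "density lborel ?t"
    unfolding Y[symmetric] by (rule prob_space_distr) measurable
  fix A :: "complex set" assume "A \<in> sets (distr M borel (\<lambda>\<omega>. X \<omega> + Y \<omega>))"
  then have [measurable]: "A \<in> sets borel" by simp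
  let ?I = "indicator A :: complex \<Rightarrow> ennreal"
  have "emeasure (distr M borel (\<lambda>\<omega>. X \<omega> + Y \<omega>)) A = (\<integral>\<^sup>+z. ?I z \<partial>distr M borel (\<lambda>\<omega>. X \<omega> + Y \<omega>))"
    by simp
  also have "\<dots> = (\<integral>\<^sup>+\<omega>. ?I (X \<omega> + Y \<omega>) \<partial>M)"
    by (rule nn_integral_distr) measurable
  also have "\<dots> = (\<integral>\<^sup>+p. ?I (fst p + snd p) \<partial>distr M (borel \<Otimes>\<^sub>M borel) (\<lambda>\<omega>. (X \<omega>, Y \<omega>)))"
    by (subst nn_integral_distr) simp_all
  also have "\<dots> = (\<integral>\<^sup>+p. ?I (fst p + snd p) \<partial>(density lborel ?s \<Otimes>\<^sub>M density lborel ?t))"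
    using indep X Y by (simp add: indep_var_distribution_eq)
  also have "\<dots> = (\<integral>\<^sup>+x. (\<integral>\<^sup>+y. ?I (x + y) \<partial>density lborel ?t) \<partial>density lborel ?s)"
    by (subst Y.nn_integral_fst[symmetric]) simp_all
  also have "\<dots> = (\<integral>\<^sup>+x. ?s x * (\<integral>\<^sup>+y. ?t y * ?I (x + y) \<partial>lborel) \<partial>lborel)"
    by (simp add: nn_integral_density)
  also have "\<dots> = (\<integral>\<^sup>+x. (\<integral>\<^sup>+y. ?s x * (?t y * ?I (x + y)) \<partial>lborel) \<partial>lborel)"
    by (intro nn_integral_cong nn_integral_cmult[symmetric]) measurable
  also have "\<dots> = (\<integral>\<^sup>+x. (\<integral>\<^sup>+w. ?s x * (?t (- x + w) * ?I (x + (- x + w))) \<partial>lborel) \<partial>lborel)"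
    by (intro nn_integral_cong nn_integral_lborel_translate[symmetric]) measurable
  also have "\<dots> = (\<integral>\<^sup>+w. (\<integral>\<^sup>+x. ?s x * (?t (- x + w) * ?I (x + (- x + w))) \<partial>lborel) \<partial>lborel)"
    by (rule lborel_pair.Fubini') measurable
  also have "\<dots> = (\<integral>\<^sup>+w. (\<integral>\<^sup>+x. (ennreal (cgauss (s + t) w) * ?I w) *
      ennreal (cgauss (s * t / (s + t)) (x - of_real (s / (s + t)) * w)) \<partial>lborel) \<partial>lborel)"
  proof (intro nn_integral_cong)
    fix w x
    have "?s x * ?t (- x + w) = ennreal (cgauss t (w - x) * cgauss s x)"
      using assms by (simp add: ennreal_mult cgauss_nonneg mult.commute)
    also have "\<dots> = ennreal (cgauss (s + t) w) * ennreal (cgauss (s * t / (s + t)) (x - of_real (s / (s + t)) * w))"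
      using assms by (simp add: cgauss_convolution ennreal_mult cgauss_nonneg)
    finally show "?s x * (?t (- x + w) * ?I (x + (- x + w))) = (ennreal (cgauss (s + t) w) * ?I w) *
      ennreal (cgauss (s * t / (s + t)) (x - of_real (s / (s + t)) * w))"
      by (simp add: mult_ac)
  qed
  also have "\<dots> = (\<integral>\<^sup>+w. ennreal (cgauss (s + t) w) * ?I w \<partial>lborel)"
    using assms by (subst nn_integral_cmult) (auto simp: nn_integral_cgauss)
  also have "\<dots> = emeasure (density lborel (\<lambda>z. ennreal (cgauss (s + t) z))) A"
    by (simp add: emeasure_density)
  finally show "emeasure (distr M borel (\<lambda>\<omega>. X \<omega> + Y \<omega>)) A = \<dots>" .
qed simp

lemma cgauss_mult:
  assumes "X \<in> borel_measurable M" "\<alpha> \<noteq> 0"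
    and X: "distr M borel X = density lborel (\<lambda>z. ennreal (cgauss s z))"
  shows "distr M borel (\<lambda>\<omega>. \<alpha> * X \<omega>) = density lborel (\<lambda>z. ennreal (cgauss ((cmod \<alpha>)\<^sup>2 * s) z))"
proof -
  note [measurable] = assms(1)
  have "distr M borel (\<lambda>\<omega>. \<alpha> * X \<omega>) = distr (density lborel (\<lambda>z. ennreal (cgauss s z))) borel ((*) \<alpha>)"
    unfolding X[symmetric] by (subst distr_distr) (auto simp: o_def)
  also have "\<dots> = distr (density lborel (\<lambda>z. ennreal (cgauss s ((\<alpha> * z) / \<alpha>)))) borel ((*) \<alpha>)"
    using assms by simp
  also have "\<dots> = density (distr lborel borel ((*) \<alpha>)) (\<lambda>z. ennreal (cgauss s (z / \<alpha>)))"
    by (rule density_distr[symmetric]) measurable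
  also have "\<dots> = density lborel (\<lambda>z. ennreal (1 / (cmod \<alpha>)\<^sup>2) * ennreal (cgauss s (z / \<alpha>)))"
    unfolding lborel_distr_mult_complex[OF assms(2)] by (rule density_density_eq) measurable
  also have "(\<lambda>z. ennreal (1 / (cmod \<alpha>)\<^sup>2) * ennreal (cgauss s (z / \<alpha>))) = (\<lambda>z. ennreal (cgauss ((cmod \<alpha>)\<^sup>2 * s) z))"
    by (auto simp: fun_eq_iff ennreal_mult'[symmetric] cgauss_def norm_divide power_divide mult_ac)
  finally show ?thesis .
qed

text \<open>\<open>c 0 \<noteq> 0\<close> keeps every partial sum nondegenerate, so that it has a
  density at all. Other coefficients may vanish, as happens for psi at z = 0.\<close>

lemma (in prob_space) cgauss_sum:
  fixes a :: "nat \<Rightarrow> 'a \<Rightarrow> complex"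
  assumes indep: "indep_vars (\<lambda>_. borel) a UNIV"
    and gauss: "\<And>m. distr M borel (a m) = density lborel (\<lambda>z. ennreal (cgauss 1 z))"
    and "c 0 \<noteq> 0"
  shows "distr M borel (\<lambda>\<omega>. \<Sum>m\<le>n. c m * a m \<omega>) = density lborel (\<lambda>z. ennreal (cgauss (\<Sum>m\<le>n. (cmod (c m))\<^sup>2) z))"
proof (induction n)
  case 0
  have "random_variable borel (a 0)" using indep by (auto simp: indep_vars_def)
  from cgauss_mult[OF this assms(3) gauss] show ?case by simp
next
  case (Suc n)
  have a: "random_variable borel (a m)" for m using indep by (auto simp: indep_vars_def)
  show ?case
  proof (cases "c (Suc n) = 0")
    case True
    then show ?thesis using Suc by simp
  next
    case False
    have pos: "(\<Sum>m\<le>n. (cmod (c m))\<^sup>2) > 0"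
      using assms(3) by (intro sum_pos2[of _ 0]) auto
    have "indep_var borel ((\<lambda>f. \<Sum>i\<le>n. c i * f i) \<circ> (\<lambda>\<omega>. restrict (\<lambda>i. a i \<omega>) {..n}))
       borel ((\<lambda>f. c (Suc n) * f (Suc n)) \<circ> (\<lambda>\<omega>. restrict (\<lambda>i. a i \<omega>) {Suc n}))"
      by (intro indep_var_compose[OF indep_var_restrict[OF indep]]) auto
    then have "indep_var borel (\<lambda>\<omega>. \<Sum>i\<le>n. c i * a i \<omega>) borel (\<lambda>\<omega>. c (Suc n) * a (Suc n) \<omega>)"
      by (simp add: o_def)
    from cgauss_add[OF this pos _ Suc cgauss_mult[OF a False gauss]] False
    show ?thesis by simp
  qed
qed

section \<open>Logarithmic moments of complex Gaussian variables\<close>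

lemma integrable_ln_norm_cgauss:
  "integrable (density lborel (\<lambda>z. ennreal (cgauss 1 z))) (\<lambda>z. ln (cmod z))"
proof (rule integrableI_bounded)
  show "(\<lambda>z. ln (cmod z)) \<in> borel_measurable (density lborel (\<lambda>z. ennreal (cgauss 1 z)))"
    by measurable
  have "(\<integral>\<^sup>+z. ennreal (norm (ln (cmod z))) \<partial>density lborel (\<lambda>z. ennreal (cgauss 1 z))) =
     (\<integral>\<^sup>+z. ennreal (cgauss 1 z) * ennreal \<bar>ln (cmod z)\<bar> \<partial>lborel)"
    by (simp add: nn_integral_density)
  \<comment> \<open>In u = |z|^2 one has ln |z| = ln u / 2, and u is exponentially distributed. Near
    0 the logarithm itself is integrable; for u > 1 the estimate ln u \<le> u \<le> 2 exp (u / 2) is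
    played against exp (- u).\<close>
  also have "\<dots> = (\<integral>\<^sup>+z. ennreal (exp (- ((cmod (z - 0))\<^sup>2)) / pi * \<bar>ln ((cmod (z - 0))\<^sup>2)\<bar> / 2) \<partial>lborel)"
    by (intro nn_integral_cong) (simp add: cgauss_def ennreal_mult[symmetric] ln_realpow abs_mult)
  also have "\<dots> = ennreal pi * (\<integral>\<^sup>+u. ennreal (exp (- u) / pi * \<bar>ln u\<bar> / 2) * indicator {0..} u \<partial>lborel)"
    by (rule nn_integral_radial) measurable
  also have "\<dots> \<le> ennreal pi * (\<integral>\<^sup>+u. ennreal (norm (indicator {0..1} u *\<^sub>R ln u)) + 2 * (ennreal (exp (- (u / 2))) * indicator {0..} u) \<partial>lborel)"
  proof (intro mult_left_mono nn_integral_mono)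
    fix u :: real
    have *: "exp (- u) / pi * \<bar>ln u\<bar> / 2 \<le> \<bar>ln u\<bar>" if "u \<ge> 0"
    proof -
      have "exp (- u) * \<bar>ln u\<bar> \<le> 1 * \<bar>ln u\<bar>"
        using that by (intro mult_right_mono) auto
      also have "\<dots> \<le> (2 * pi) * \<bar>ln u\<bar>"
        using pi_gt3 by (intro mult_right_mono) auto
      finally show ?thesis by (simp add: field_simps)
    qed
    have **: "exp (- u) / pi * \<bar>ln u\<bar> / 2 \<le> 2 * exp (- (u / 2))" if "u > 1"
    proof -
      have "\<bar>ln u\<bar> \<le> u" using that ln_bound[of u] by simp
      also have "u \<le> 2 * exp (u / 2)" using exp_ge_add_one_self[of "u / 2"] that by linarith
      finally have "exp (- u) * \<bar>ln u\<bar> \<le> exp (- u) * (2 * exp (u / 2))"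
        by (intro mult_left_mono) auto
      also have "\<dots> = 2 * exp (- (u / 2))"
        using exp_add[of "- u" "u / 2"] by simp
      also have "\<dots> \<le> (2 * pi) * (2 * exp (- (u / 2)))"
        using pi_gt3 by simp
      finally show ?thesis by (simp add: field_simps)
    qed
    show "ennreal (exp (- u) / pi * \<bar>ln u\<bar> / 2) * indicator {0..} u \<le>
       ennreal (norm (indicator {0..1} u *\<^sub>R ln u)) + 2 * (ennreal (exp (- (u / 2))) * indicator {0..} u)"
    proof (cases "u \<in> {0..1}")
      case True
      then have "ennreal (exp (- u) / pi * \<bar>ln u\<bar> / 2) * indicator {0..} u \<le> ennreal (norm (indicator {0..1} u *\<^sub>R ln u)) + 0"
        using * by (auto simp: indicator_def intro!: ennreal_leI)
      also have "\<dots> \<le> ennreal (norm (indicator {0..1} u *\<^sub>R ln u)) + 2 * (ennreal (exp (- (u / 2))) * indicator {0..} u)"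
        by (intro add_left_mono) simp
      finally show ?thesis .
    next
      case False
      have "ennreal (exp (- u) / pi * \<bar>ln u\<bar> / 2) \<le> 2 * ennreal (exp (- (u / 2)))" if "u > 1"
        using **[OF that] by (simp add: ennreal_mult'[symmetric] flip: ennreal_numeral)
      then show ?thesis using False by (auto simp: indicator_def)
    qed
  qed simp
  also have "\<dots> = ennreal pi * ((\<integral>\<^sup>+u. ennreal (norm (indicator {0..1::real} u *\<^sub>R ln u)) \<partial>lborel) + 2 * ennreal 2)"
    by (subst nn_integral_add) (auto simp: nn_integral_cmult nn_integral_exp_decay)
  also have "\<dots> < \<infinity>"
    using ln_set_integrable[of 1] unfolding set_integrable_def integrable_iff_bounded
    by (auto simp: ennreal_mult_less_top)
  finally show "(\<integral>\<^sup>+z. ennreal (norm (ln (cmod z))) \<partial>density lborel (\<lambda>z. ennreal (cgauss 1 z))) < \<infinity>" .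
qed

text \<open>The value is left open: it enters as an additive constant, and \<open>bump_lap\<close>
  integrates constants to 0.\<close>

definition ln_cgauss_mean :: real where
  "ln_cgauss_mean = (\<integral>z. ln (cmod z) \<partial>density lborel (\<lambda>z. ennreal (cgauss 1 z)))"

text \<open>Serves the domination estimate for Fubini.\<close>

definition ln_cgauss_abs_mean :: real where
  "ln_cgauss_abs_mean = (\<integral>z. \<bar>ln (cmod z)\<bar> \<partial>density lborel (\<lambda>z. ennreal (cgauss 1 z)))"

text \<open>X has the law of sqrt s times a standard variable, so ln |X| is shifted by ln s / 2. The
  third claim supplies the domination for Fubini; the fourth will exclude the zero polynomial almost
  surely.\<close>

lemma cgauss_ln_norm:
  assumes [measurable]: "X \<in> borel_measurable M" and "s > 0"
    and X: "distr M borel X = density lborel (\<lambda>z. ennreal (cgauss s z))"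
  shows "integrable M (\<lambda>\<omega>. ln (cmod (X \<omega>)))" (is ?thesis1)
    and "(\<integral>\<omega>. ln (cmod (X \<omega>)) \<partial>M) = ln s / 2 + ln_cgauss_mean" (is ?thesis2)
    and "(\<integral>\<omega>. \<bar>ln (cmod (X \<omega>))\<bar> \<partial>M) \<le> \<bar>ln s\<bar> / 2 + ln_cgauss_abs_mean" (is ?thesis3)
    and "AE \<omega> in M. X \<omega> \<noteq> 0" (is ?thesis4)
proof -
  define G where "G = density lborel (\<lambda>z. ennreal (cgauss 1 z))"
  have [measurable_cong, simp]: "sets G = sets borel" by (simp add: G_def)
  interpret G: prob_space G
    by (rule prob_spaceI) (use nn_integral_cgauss[of 1 0] in \<open>simp add: G_def emeasure_density\<close>)
  define r :: complex where "r = of_real (sqrt s)"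
  have r: "r \<noteq> 0" "(cmod r)\<^sup>2 = s" "ln (cmod r) = ln s / 2" using assms by (auto simp: r_def ln_sqrt)
  have law: "distr M borel X = distr G borel ((*) r)"
  proof -
    have "distr G borel (\<lambda>z. z) = G" by (rule distr_id2) simp
    then have "distr G borel (\<lambda>z. r * z) = density lborel (\<lambda>z. ennreal (cgauss ((cmod r)\<^sup>2 * 1) z))"
      using r by (intro cgauss_mult[where X = "\<lambda>z. z"]) (simp_all add: G_def)
    then show ?thesis using X r by simp
  qed
  have nz: "AE z in G. z \<noteq> 0"
  proof -
    have "AE z in lborel. (z::complex) \<noteq> 0"
      by (rule AE_lborel_singleton)
    then show ?thesis unfolding G_def by (subst AE_density) auto
  qed
  have ln: "integrable G (\<lambda>z. ln (cmod z))"
    using integrable_ln_norm_cgauss by (simp add: G_def)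
  have eq: "AE z in G. ln (cmod (r * z)) = ln s / 2 + ln (cmod z)"
    using nz by eventually_elim (use r in \<open>simp add: norm_mult ln_mult\<close>)
  have int: "integrable G (\<lambda>z. ln (cmod (r * z)))"
    by (subst integrable_cong_AE[OF _ _ eq]) (use ln in auto)
  have "integrable (distr M borel X) (\<lambda>z. ln (cmod z))"
    unfolding law by (subst integrable_distr_eq) (use int in auto)
  then show ?thesis1
    by (subst (asm) integrable_distr_eq) auto
  have "(\<integral>\<omega>. ln (cmod (X \<omega>)) \<partial>M) = (\<integral>z. ln (cmod z) \<partial>distr M borel X)"
    by (subst integral_distr) auto
  also have "\<dots> = (\<integral>z. ln (cmod (r * z)) \<partial>G)"
    unfolding law by (subst integral_distr) auto
  also have "\<dots> = (\<integral>z. ln s / 2 + ln (cmod z) \<partial>G)"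
    by (rule integral_cong_AE[OF _ _ eq]) auto
  also have "\<dots> = ln s / 2 + ln_cgauss_mean"
    using ln by (simp add: ln_cgauss_mean_def G_def[symmetric] G.prob_space)
  finally show ?thesis2 .
  have "(\<integral>\<omega>. \<bar>ln (cmod (X \<omega>))\<bar> \<partial>M) = (\<integral>z. \<bar>ln (cmod z)\<bar> \<partial>distr M borel X)"
    by (subst integral_distr) auto
  also have "\<dots> = (\<integral>z. \<bar>ln (cmod (r * z))\<bar> \<partial>G)"
    unfolding law by (subst integral_distr) auto
  also have "\<dots> \<le> (\<integral>z. \<bar>ln s\<bar> / 2 + \<bar>ln (cmod z)\<bar> \<partial>G)"
  proof (rule integral_mono_AE)
    show "AE z in G. \<bar>ln (cmod (r * z))\<bar> \<le> \<bar>ln s\<bar> / 2 + \<bar>ln (cmod z)\<bar>"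
      using eq by eventually_elim linarith
  qed (use int ln in auto)
  also have "\<dots> = \<bar>ln s\<bar> / 2 + ln_cgauss_abs_mean"
    using ln by (simp add: ln_cgauss_abs_mean_def G_def[symmetric] G.prob_space)
  finally show ?thesis3 .
  have "AE z in distr M borel X. z \<noteq> 0"
    unfolding law by (subst AE_distr_iff) (use nz r in auto)
  then show ?thesis4
    by (subst (asm) AE_distr_iff) auto
qed

subsection \<open>Expected zero counting\<close>

definition su11_kernel :: "nat \<Rightarrow> nat \<Rightarrow> real \<Rightarrow> real" where
  "su11_kernel L N x = (\<Sum>m\<le>N. real ((m + L - 1) choose m) * x ^ m)"

lemma su11_kernel_ge_1: "x \<ge> 0 \<Longrightarrow> su11_kernel L N x \<ge> 1"
proof -
  assume "x \<ge> 0"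
  have "(\<Sum>m\<in>{0}. real ((m + L - 1) choose m) * x ^ m) \<le> su11_kernel L N x"
    unfolding su11_kernel_def using \<open>x \<ge> 0\<close> by (intro sum_mono2) auto
  then show ?thesis by simp
qed

lemma su11_kernel_mono: "0 \<le> x \<Longrightarrow> x \<le> y \<Longrightarrow> su11_kernel L N x \<le> su11_kernel L N y"
  unfolding su11_kernel_def by (intro sum_mono mult_left_mono power_mono) auto

lemma poly_Poly_map_upt:
  fixes f :: "nat \<Rightarrow> 'a::comm_semiring_1"
  shows "poly (Poly (map f [0..<n])) z = (\<Sum>m<n. f m * z ^ m)"
  by (induction n) (simp_all add: Poly_snoc poly_monom)

lemma poly_su11_poly:
  "poly (su11_poly L N a) z = (\<Sum>m\<le>N. complex_of_real (sqrt (real ((m + L - 1) choose m))) * z ^ m * a m)"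
  unfolding su11_poly_def poly_Poly_map_upt by (simp add: lessThan_Suc_atMost mult_ac)

text \<open>For L \<ge> 1 no binomial coefficient vanishes, so the event psi = 0 is described by
  finitely many Gaussian coefficients and is visibly measurable.\<close>

lemma su11_poly_eq_0_iff:
  assumes "L \<ge> 1"
  shows "su11_poly L N a = 0 \<longleftrightarrow> (\<forall>m\<le>N. a m = 0)"
proof -
  have "su11_poly L N a = 0 \<longleftrightarrow> (\<forall>m\<le>N. complex_of_real (sqrt (real ((m + L - 1) choose m))) * a m = 0)"
    unfolding su11_poly_def poly_eq_iff coeff_Poly_eq nth_default_def by (auto simp: less_Suc_eq_le nth_map_upt simp del: upt_Suc)
  then show ?thesis using assms by auto
qed

text \<open>Fubini applied to the pathwise formula \<open>zero_sum_bump\<close>: the expectation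
  moves inside both integrals, where 2 ln |psi(z)| has an explicit mean.\<close>

lemma (in prob_space) expectation_zero_sum_bump:
  fixes a :: "nat \<Rightarrow> 'a \<Rightarrow> complex"
  assumes L: "L \<ge> 1" and \<epsilon>: "\<epsilon> > 0"
    and indep: "indep_vars (\<lambda>_. borel) a UNIV"
    and gauss: "\<And>m. distr M borel (a m) = density lborel (\<lambda>z. ennreal (cgauss 1 z))"
  shows "expectation (\<lambda>\<omega>. zero_sum (su11_poly L N (\<lambda>m. a m \<omega>)) (\<lambda>z. bump 0 (1 - (cmod (z - z0))\<^sup>2 / \<epsilon>))) =
    (\<integral>u. (\<integral>t. bump_lap \<epsilon> u * (ln (su11_kernel L N ((cmod (z0 + of_real (sqrt u) * unit_circle t))\<^sup>2)) + 2 * ln_cgauss_mean)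
        \<partial>lborel_Icc 0 1) \<partial>lborel_Icc 0 \<epsilon>)" (is "?lhs = ?rhs")
proof -
  define P where "P = (\<lambda>\<omega>. su11_poly L N (\<lambda>m. a m \<omega>))"
  define z where "z = (\<lambda>w. z0 + of_real (sqrt (fst w)) * unit_circle (snd w))"
  define c where "c = (\<lambda>y m. complex_of_real (sqrt (real ((m + L - 1) choose m))) * y ^ m)"
  define f where "f = (\<lambda>\<omega> w. bump_lap \<epsilon> (fst w) * (2 * ln (cmod (poly (P \<omega>) (z w)))))"
  define U where "U = lborel_Icc 0 \<epsilon>"
  define T where "T = lborel_Icc 0 1"
  interpret U: finite_measure U unfolding U_def by (rule finite_measure_lborel_Icc)
  interpret T: finite_measure T unfolding T_def by (rule finite_measure_lborel_Icc)
  interpret UT: pair_sigma_finite U T ..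
  interpret W: finite_measure "U \<Otimes>\<^sub>M T" by (rule finite_measure_pair_measure) unfold_locales
  interpret WM: pair_sigma_finite "U \<Otimes>\<^sub>M T" M ..
  interpret MW: pair_sigma_finite M "U \<Otimes>\<^sub>M T" ..
  have a [measurable]: "a m \<in> borel_measurable M" for m
    using indep by (auto simp: indep_vars_def)
  have [measurable]: "fst \<in> borel_measurable (U \<Otimes>\<^sub>M T)" "snd \<in> borel_measurable (U \<Otimes>\<^sub>M T)"
    unfolding U_def T_def by (rule fst_measurable_lborel_Icc snd_measurable_lborel_Icc)+
  have [measurable]: "z \<in> borel_measurable (U \<Otimes>\<^sub>M T)"
    unfolding z_def by measurable
  have poly_P: "poly (P \<omega>) y = (\<Sum>m\<le>N. c y m * a m \<omega>)" for \<omega> y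
    by (simp add: P_def poly_su11_poly c_def)
  have [measurable]: "(\<lambda>\<omega>. poly (P \<omega>) y) \<in> borel_measurable M" for y
    unfolding poly_P c_def by measurable
  have meas_M: "(\<lambda>p. poly (P (fst p)) (z (snd p))) \<in> borel_measurable (M \<Otimes>\<^sub>M (U \<Otimes>\<^sub>M T))"
    unfolding poly_P c_def by measurable
  have meas_f: "(\<lambda>p. f (fst p) (snd p)) \<in> borel_measurable (M \<Otimes>\<^sub>M (U \<Otimes>\<^sub>M T))"
    unfolding f_def using meas_M by measurable
  have meas_W: "(\<lambda>p. f (snd p) (fst p)) \<in> borel_measurable ((U \<Otimes>\<^sub>M T) \<Otimes>\<^sub>M M)"
    using measurable_compose[OF measurable_pair_swap' meas_f] by (simp add: split_beta)
  have law: "distr M borel (\<lambda>\<omega>. poly (P \<omega>) y) = density lborel (\<lambda>x. ennreal (cgauss (su11_kernel L N ((cmod y)\<^sup>2)) x))" for y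
  proof -
    have "(\<Sum>m\<le>N. (cmod (c y m))\<^sup>2) = su11_kernel L N ((cmod y)\<^sup>2)"
      by (simp add: su11_kernel_def c_def norm_mult norm_power power_mult_distrib power_mult[symmetric] mult.commute)
    then show ?thesis
      unfolding poly_P using cgauss_sum[OF indep gauss, of "c y" N] by (simp add: c_def)
  qed
  have kpos: "su11_kernel L N ((cmod y)\<^sup>2) \<ge> 1" for y
    by (rule su11_kernel_ge_1) simp
  then have kpos': "su11_kernel L N ((cmod y)\<^sup>2) > 0" for y
    by (meson less_le_trans zero_less_one)
  have lnX: "integrable M (\<lambda>\<omega>. ln (cmod (poly (P \<omega>) y)))"
      "expectation (\<lambda>\<omega>. ln (cmod (poly (P \<omega>) y))) = ln (su11_kernel L N ((cmod y)\<^sup>2)) / 2 + ln_cgauss_mean"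
      "expectation (\<lambda>\<omega>. \<bar>ln (cmod (poly (P \<omega>) y))\<bar>) \<le> \<bar>ln (su11_kernel L N ((cmod y)\<^sup>2))\<bar> / 2 + ln_cgauss_abs_mean"
      "AE \<omega> in M. poly (P \<omega>) y \<noteq> 0" for y
    by (rule cgauss_ln_norm[OF _ kpos' law], measurable)+
  obtain Q where Q: "Q > 0" "\<And>\<epsilon> u. \<epsilon> > 0 \<Longrightarrow> u \<in> {0..\<epsilon>} \<Longrightarrow> \<bar>bump_lap \<epsilon> u\<bar> \<le> Q / \<epsilon>"
    by (rule bump_lap_bound) blast
  \<comment> \<open>\<open>R\<close> bounds |z|^2 on the disc of radius
    \<open>sqrt \<epsilon>\<close> about \<open>z0\<close>. As the kernel is monotone and at least
    1, \<open>B\<close> then bounds the expectation of |f| at every point of the disc.\<close>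
  define R where "R = (cmod z0 + sqrt \<epsilon>)\<^sup>2"
  define B where "B = Q / \<epsilon> * (2 * (\<bar>ln (su11_kernel L N R)\<bar> / 2 + ln_cgauss_abs_mean))"
  have int: "integrable ((U \<Otimes>\<^sub>M T) \<Otimes>\<^sub>M M) (\<lambda>p. f (snd p) (fst p))"
  proof (rule WM.Fubini_integrable[OF meas_W], goal_cases)
    case 1
    show ?case
    proof (rule W.integrable_const_bound[where B = B], rule AE_I2)
      fix w assume "w \<in> space (U \<Otimes>\<^sub>M T)"
      then have w: "fst w \<in> {0..\<epsilon>}" by (auto simp: space_pair_measure U_def space_restrict_space)
      have "cmod (z w) \<le> cmod z0 + sqrt (fst w)"
        unfolding z_def using norm_triangle_ineq[of z0 "of_real (sqrt (fst w)) * unit_circle (snd w)"] w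
        by (simp add: norm_mult)
      also have "\<dots> \<le> cmod z0 + sqrt \<epsilon>" using w by simp
      finally have "(cmod (z w))\<^sup>2 \<le> R" unfolding R_def by (intro power_mono) auto
      then have "su11_kernel L N ((cmod (z w))\<^sup>2) \<le> su11_kernel L N R"
        by (intro su11_kernel_mono) auto
      then have "\<bar>ln (su11_kernel L N ((cmod (z w))\<^sup>2))\<bar> \<le> \<bar>ln (su11_kernel L N R)\<bar>"
        using kpos[of "z w"] by simp
      then have *: "expectation (\<lambda>\<omega>. \<bar>ln (cmod (poly (P \<omega>) (z w)))\<bar>) \<le> \<bar>ln (su11_kernel L N R)\<bar> / 2 + ln_cgauss_abs_mean"
        using lnX(3)[of "z w"] by linarith
      have "expectation (\<lambda>\<omega>. norm (f (snd (w, \<omega>)) (fst (w, \<omega>)))) = \<bar>bump_lap \<epsilon> (fst w)\<bar> * (2 * expectation (\<lambda>\<omega>. \<bar>ln (cmod (poly (P \<omega>) (z w)))\<bar>))"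
        by (simp add: f_def abs_mult)
      also have "\<dots> \<le> B"
        unfolding B_def using * Q(1) \<epsilon> w by (intro mult_mono Q(2)) auto
      finally show "norm (expectation (\<lambda>\<omega>. norm (f (snd (w, \<omega>)) (fst (w, \<omega>))))) \<le> B"
        by simp
    next
      show "(\<lambda>w. expectation (\<lambda>\<omega>. norm (f (snd (w, \<omega>)) (fst (w, \<omega>))))) \<in> borel_measurable (U \<Otimes>\<^sub>M T)"
        using meas_W by (intro borel_measurable_lebesgue_integral) (simp add: split_beta')
    qed
  next
    case 2
    show ?case unfolding f_def using lnX(1) by (intro AE_I2) auto
  qed
  have int': "integrable (M \<Otimes>\<^sub>M (U \<Otimes>\<^sub>M T)) (\<lambda>p. f (fst p) (snd p))"
    using WM.integrable_product_swap[OF int] by (simp add: split_beta')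
  have sec: "integrable (U \<Otimes>\<^sub>M T) (\<lambda>w. expectation (\<lambda>\<omega>. f \<omega> w))"
    using WM.integrable_fst'[OF int] by simp
  \<comment> \<open>Almost surely psi does not vanish at the single point \<open>z0\<close>, which
    already rules out the zero polynomial.\<close>
  have J: "AE \<omega> in M. (\<integral>w. f \<omega> w \<partial>(U \<Otimes>\<^sub>M T)) = zero_sum (P \<omega>) (\<lambda>z. bump 0 (1 - (cmod (z - z0))\<^sup>2 / \<epsilon>))"
    using MW.AE_integrable_fst'[OF int'] lnX(4)[of z0]
  proof eventually_elim
    case (elim \<omega>)
    then have "P \<omega> \<noteq> 0" by auto
    have "(\<integral>w. f \<omega> w \<partial>(U \<Otimes>\<^sub>M T)) = (\<integral>u. (\<integral>t. f \<omega> (u, t) \<partial>T) \<partial>U)"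
      using UT.integral_fst'[of "f \<omega>"] elim by simp
    also have "\<dots> = zero_sum (P \<omega>) (\<lambda>z. bump 0 (1 - (cmod (z - z0))\<^sup>2 / \<epsilon>))"
      unfolding zero_sum_bump[OF \<open>P \<omega> \<noteq> 0\<close> \<epsilon>] by (simp add: f_def U_def T_def z_def)
    finally show ?case .
  qed
  have meas_zero_sum: "(\<lambda>\<omega>. zero_sum (P \<omega>) (\<lambda>z. bump 0 (1 - (cmod (z - z0))\<^sup>2 / \<epsilon>))) \<in> borel_measurable M"
  proof -
    \<comment> \<open>For the zero polynomial \<open>zero_sum\<close> runs over the infinite set of
      all complex numbers and is 0 by convention. Everywhere else the pathwise formula holds, so
      measurability is inherited from the double integral.\<close>
    have eq: "zero_sum (P \<omega>) (\<lambda>z. bump 0 (1 - (cmod (z - z0))\<^sup>2 / \<epsilon>)) =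
       (if \<forall>m\<le>N. a m \<omega> = 0 then 0 else (\<integral>u. (\<integral>t. f \<omega> (u, t) \<partial>T) \<partial>U))" for \<omega>
    proof (cases "P \<omega> = 0")
      case True
      then have "\<forall>m\<le>N. a m \<omega> = 0" using su11_poly_eq_0_iff[OF L] by (simp add: P_def)
      moreover have "zero_sum (P \<omega>) (\<lambda>z. bump 0 (1 - (cmod (z - z0))\<^sup>2 / \<epsilon>)) = 0"
        using True infinite_UNIV_char_0[where ?'a = complex] by (simp add: zero_sum_def)
      ultimately show ?thesis by simp
    next
      case False
      then have "\<not> (\<forall>m\<le>N. a m \<omega> = 0)" using su11_poly_eq_0_iff[OF L] by (simp add: P_def)
      then show ?thesis
        unfolding zero_sum_bump[OF False \<epsilon>] by (subst if_not_P) (simp_all add: f_def U_def T_def z_def)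
    qed
    have "(\<lambda>q. f (fst (fst q)) (snd (fst q), snd q)) \<in> borel_measurable ((M \<Otimes>\<^sub>M U) \<Otimes>\<^sub>M T)"
      using measurable_compose[OF _ meas_f, of "\<lambda>q. (fst (fst q), (snd (fst q), snd q))" "(M \<Otimes>\<^sub>M U) \<Otimes>\<^sub>M T"] by simp
    then have "(\<lambda>p. \<integral>t. f (fst p) (snd p, t) \<partial>T) \<in> borel_measurable (M \<Otimes>\<^sub>M U)"
      by (intro T.borel_measurable_lebesgue_integral) (simp add: split_beta')
    then have [measurable]: "(\<lambda>\<omega>. (\<integral>u. (\<integral>t. f \<omega> (u, t) \<partial>T) \<partial>U)) \<in> borel_measurable M"
      by (intro U.borel_measurable_lebesgue_integral) (simp add: split_beta')
    show ?thesis unfolding eq by measurable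
  qed
  have "?lhs = expectation (\<lambda>\<omega>. zero_sum (P \<omega>) (\<lambda>z. bump 0 (1 - (cmod (z - z0))\<^sup>2 / \<epsilon>)))"
    by (simp add: P_def)
  also have "\<dots> = expectation (\<lambda>\<omega>. \<integral>w. f \<omega> w \<partial>(U \<Otimes>\<^sub>M T))"
  proof (rule integral_cong_AE[OF meas_zero_sum])
    show "(\<lambda>\<omega>. \<integral>w. f \<omega> w \<partial>(U \<Otimes>\<^sub>M T)) \<in> borel_measurable M"
      using meas_f by (intro sigma_finite_measure.borel_measurable_lebesgue_integral[OF W.sigma_finite_measure]) (simp add: split_beta')
  qed (use J in \<open>auto elim: eventually_mono\<close>)
  also have "\<dots> = (\<integral>w. expectation (\<lambda>\<omega>. f \<omega> w) \<partial>(U \<Otimes>\<^sub>M T))"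
    using MW.Fubini_integral[of f] int' by (simp add: split_beta')
  also have "\<dots> = (\<integral>u. (\<integral>t. expectation (\<lambda>\<omega>. f \<omega> (u, t)) \<partial>T) \<partial>U)"
    using UT.integral_fst'[OF sec] by simp
  also have "\<dots> = ?rhs"
    unfolding U_def T_def f_def z_def
    by (simp add: lnX(2) algebra_simps)
  finally show ?thesis .
qed

subsection \<open>Localisation of the density\<close>

text \<open>For the square, (Re y)^2 = (|y|^2 + Re (y^2)) / 2, and y^2 is holomorphic in the circle
  variable with value 0 at the centre.\<close>

lemma circle_mean_Re:
  "((\<lambda>t. Re (w * unit_circle t)) has_integral 0) {0..1}"
  "((\<lambda>t. (Re (w * unit_circle t))\<^sup>2) has_integral (cmod w)\<^sup>2 / 2) {0..1}"
proof -
  have "((\<lambda>t. w * (of_real 1 * unit_circle t)) has_integral w * 0) {0..1}"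
    by (rule circle_mean_holomorphic) (auto intro!: holomorphic_intros)
  from has_integral_linear[OF this bounded_linear_Re]
  show "((\<lambda>t. Re (w * unit_circle t)) has_integral 0) {0..1}" by (simp add: o_def)
  have "((\<lambda>t. (w * (of_real 1 * unit_circle t))\<^sup>2) has_integral (w * 0)\<^sup>2) {0..1}"
    by (rule circle_mean_holomorphic) (auto intro!: holomorphic_intros)
  from has_integral_linear[OF this bounded_linear_Re]
  have 1: "((\<lambda>t. Re ((w * unit_circle t)\<^sup>2)) has_integral 0) {0..1}" by (simp add: o_def)
  have "((\<lambda>t. ((cmod w)\<^sup>2 + Re ((w * unit_circle t)\<^sup>2)) / 2) has_integral ((cmod w)\<^sup>2 + 0) / 2) {0..1}"
    using has_integral_const_real[of "(cmod w)\<^sup>2" 0 1]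
    by (intro has_integral_divide has_integral_add 1) simp
  moreover have "((cmod w)\<^sup>2 + Re ((w * unit_circle t)\<^sup>2)) / 2 = (Re (w * unit_circle t))\<^sup>2" for t
  proof -
    have "(cmod w)\<^sup>2 = (cmod (w * unit_circle t))\<^sup>2" by (simp add: norm_mult)
    also have "\<dots> = (Re (w * unit_circle t))\<^sup>2 + (Im (w * unit_circle t))\<^sup>2" by (rule cmod_power2)
    finally show ?thesis by (simp add: Re_power2)
  qed
  ultimately show "((\<lambda>t. (Re (w * unit_circle t))\<^sup>2) has_integral (cmod w)\<^sup>2 / 2) {0..1}"
    by simp
qed

lemma integral_lborel_Icc_continuous:
  fixes f :: "real \<Rightarrow> real"
  assumes "continuous_on {a..b} f"
  shows "integrable (lborel_Icc a b) f" and "(f has_integral I) {a..b} \<Longrightarrow> integral\<^sup>L (lborel_Icc a b) f = I"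
    and "integral\<^sup>L (lborel_Icc a b) f = integral {a..b} f"
proof -
  have *: "set_integrable lborel {a..b} f" by (rule borel_integrable_atLeastAtMost'[OF assms])
  then show "integrable (lborel_Icc a b) f" by (simp add: integrable_lborel_Icc)
  show "(f has_integral I) {a..b} \<Longrightarrow> integral\<^sup>L (lborel_Icc a b) f = I"
    by (rule integral_lborel_Icc[OF *])
  show "integral\<^sup>L (lborel_Icc a b) f = integral {a..b} f"
    by (rule integral_lborel_Icc[OF *]) (use assms integrable_continuous_real integrable_integral in blast)
qed

lemma bump_profile_continuous: "\<epsilon> > 0 \<Longrightarrow> continuous_on S (\<lambda>u. bump k (1 - u / \<epsilon>))"
  by (rule continuous_on_compose2[OF bump_continuous[of UNIV]]) (auto intro!: continuous_intros)

definition bump_mass :: "real \<Rightarrow> real" where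
  "bump_mass \<epsilon> = (\<integral>u. bump 0 (1 - u / \<epsilon>) \<partial>lborel_Icc 0 \<epsilon>)"

text \<open>On the half interval u \<le> \<epsilon> / 2 the profile is at least exp (-2). The mass
  is thus of order \<open>\<epsilon>\<close>, so errors that are o(\<epsilon>) survive division by
  it.\<close>

lemma bump_mass_lower:
  assumes "\<epsilon> > 0"
  shows "bump_mass \<epsilon> \<ge> exp (-2) / 2 * \<epsilon>"
proof -
  have "integral {0..\<epsilon>/2} (\<lambda>u. exp (-2::real)) \<le> integral {0..\<epsilon>/2} (\<lambda>u. bump 0 (1 - u / \<epsilon>))"
  proof (rule integral_le)
    fix u assume "u \<in> {0..\<epsilon>/2}"
    then have *: "1 - u / \<epsilon> \<ge> 1 / 2" using assms by (auto simp: field_simps)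
    have pos: "1 - u / \<epsilon> > 0" using * by linarith
    have "1 / (1 - u / \<epsilon>) \<le> 1 / (1 / 2)" using * pos by (intro divide_left_mono) auto
    with pos show "exp (- 2) \<le> bump 0 (1 - u / \<epsilon>)" by (simp add: bump_def)
  qed (use assms in \<open>auto intro!: integrable_continuous_real bump_profile_continuous\<close>)
  also have "\<dots> \<le> integral {0..\<epsilon>} (\<lambda>u. bump 0 (1 - u / \<epsilon>))"
    using assms
    by (intro integral_subset_le integrable_continuous_real bump_profile_continuous) (auto simp: bump_nonneg)
  also have "\<dots> = bump_mass \<epsilon>"
    unfolding bump_mass_def using assms by (intro integral_lborel_Icc_continuous(3)[symmetric] bump_profile_continuous)
  finally show ?thesis using assms by (simp add: field_simps)
qed

lemma bump_radial_integral:
  assumes "\<epsilon> > 0"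
  shows "has_bochner_integral lborel (\<lambda>z. bump 0 (1 - (cmod (z - z0))\<^sup>2 / \<epsilon>)) (pi * bump_mass \<epsilon>)"
proof (rule has_bochner_integral_nn_integral)
  have int: "integrable lborel (\<lambda>u. indicator {0..\<epsilon>} u * bump 0 (1 - u / \<epsilon>))"
    using integral_lborel_Icc_continuous(1)[OF bump_profile_continuous[OF assms], of 0 \<epsilon> 0]
    by (simp add: integrable_lborel_Icc set_integrable_def)
  have "(\<integral>\<^sup>+z. ennreal (bump 0 (1 - (cmod (z - z0))\<^sup>2 / \<epsilon>)) \<partial>lborel) =
     ennreal pi * (\<integral>\<^sup>+u. ennreal (bump 0 (1 - u / \<epsilon>)) * indicator {0..} u \<partial>lborel)"
    by (rule nn_integral_radial) measurable
  also have "(\<integral>\<^sup>+u. ennreal (bump 0 (1 - u / \<epsilon>)) * indicator {0..} u \<partial>lborel) =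
      (\<integral>\<^sup>+u. ennreal (indicator {0..\<epsilon>} u * bump 0 (1 - u / \<epsilon>)) \<partial>lborel)"
  proof (intro nn_integral_cong)
    fix u
    have "bump 0 (1 - u / \<epsilon>) = 0" if "u > \<epsilon>"
      using that assms by (intro bump_eq_0) (auto simp: field_simps)
    then show "ennreal (bump 0 (1 - u / \<epsilon>)) * indicator {0..} u = ennreal (indicator {0..\<epsilon>} u * bump 0 (1 - u / \<epsilon>))"
      by (auto simp: indicator_def)
  qed
  also have "\<dots> = ennreal (\<integral>u. indicator {0..\<epsilon>} u * bump 0 (1 - u / \<epsilon>) \<partial>lborel)"
    by (rule nn_integral_eq_integral[OF int]) (auto simp: bump_nonneg)
  also have "(\<integral>u. indicator {0..\<epsilon>} u * bump 0 (1 - u / \<epsilon>) \<partial>lborel) = bump_mass \<epsilon>"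
    by (simp add: bump_mass_def integral_restrict_space)
  finally show "(\<integral>\<^sup>+z. ennreal (bump 0 (1 - (cmod (z - z0))\<^sup>2 / \<epsilon>)) \<partial>lborel) = ennreal (pi * bump_mass \<epsilon>)"
    by (simp add: ennreal_mult')
  have "0 < exp (-2) / 2 * \<epsilon>" using assms by simp
  then show "0 \<le> pi * bump_mass \<epsilon>"
    using bump_mass_lower[OF assms] by simp
qed (auto simp: bump_nonneg)

text \<open>Paired with \<open>bump_lap\<close>, an affine function G0 + D u yields D times the
  mass, which isolates the coefficient D.\<close>

lemma bump_lap_moments:
  assumes "\<epsilon> > 0"
  shows "(\<integral>u. bump_lap \<epsilon> u \<partial>lborel_Icc 0 \<epsilon>) = 0" "(\<integral>u. bump_lap \<epsilon> u * u \<partial>lborel_Icc 0 \<epsilon>) = bump_mass \<epsilon>"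
proof -
  show "(\<integral>u. bump_lap \<epsilon> u \<partial>lborel_Icc 0 \<epsilon>) = 0"
    by (rule integral_lborel_Icc_continuous(2)[OF bump_lap_continuous bump_lap_integral_0[OF assms]])
  have c1: "continuous_on {0..\<epsilon>} (\<lambda>u. u * bump_lap \<epsilon> u)"
    by (intro continuous_intros bump_lap_continuous)
  note c2 = bump_profile_continuous[OF assms, of "{0..\<epsilon>}" 0]
  have "(\<integral>u. u * bump_lap \<epsilon> u - bump 0 (1 - u / \<epsilon>) \<partial>lborel_Icc 0 \<epsilon>) = 0"
    by (rule integral_lborel_Icc_continuous(2)[OF _ bump_lap_integral_id[OF assms]])
       (intro continuous_intros c1 c2)
  then show "(\<integral>u. bump_lap \<epsilon> u * u \<partial>lborel_Icc 0 \<epsilon>) = bump_mass \<epsilon>"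
    using Bochner_Integration.integral_diff[OF integral_lborel_Icc_continuous(1)[OF c1] integral_lborel_Icc_continuous(1)[OF c2]]
    by (simp add: bump_mass_def mult.commute)
qed

text \<open>On the circle of squared radius u, |z|^2 exceeds |z0|^2 by a quantity with mean u and
  mean square 2 |z0|^2 u + u^2. The order-u coefficient is therefore G' + x G'' at x = |z0|^2; the
  cubic remainder and the u^2 term are O(u^(3/2)).\<close>

lemma circle_mean_taylor:
  fixes G :: "real \<Rightarrow> real" and z0 :: complex
  assumes [measurable]: "G \<in> borel_measurable borel"
    and taylor: "\<And>\<delta>. \<bar>\<delta>\<bar> \<le> \<delta>0 \<Longrightarrow> \<bar>G ((cmod z0)\<^sup>2 + \<delta>) - (G0 + G1 * \<delta> + G2 / 2 * \<delta>\<^sup>2)\<bar> \<le> C * \<bar>\<delta>\<bar> ^ 3"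
    and "C \<ge> 0" and u: "0 \<le> u" "u \<le> 1" "(2 * cmod z0 + 1) * sqrt u \<le> \<delta>0"
  shows "\<bar>(\<integral>t. G ((cmod (z0 + of_real (sqrt u) * unit_circle t))\<^sup>2) \<partial>lborel_Icc 0 1) - (G0 + (G1 + (cmod z0)\<^sup>2 * G2) * u)\<bar>
     \<le> (C * (2 * cmod z0 + 1) ^ 3 + \<bar>G2\<bar>) * (sqrt u * u)"
proof -
  interpret T: finite_measure "lborel_Icc 0 1" by (rule finite_measure_lborel_Icc)
  have prob: "measure (lborel_Icc 0 1) {0..1} = 1"
    by (simp add: measure_restrict_space)
  define R where "R = 2 * cmod z0 + 1"
  define w where "w = 2 * of_real (sqrt u) * cnj z0"
  define d where "d = (\<lambda>t. Re (w * unit_circle t) + u)"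
  have su: "sqrt u \<le> 1" "u \<le> sqrt u"
    using u by (auto intro: real_le_rsqrt simp: power2_eq_square mult_left_le)
  have d: "(cmod (z0 + of_real (sqrt u) * unit_circle t))\<^sup>2 = (cmod z0)\<^sup>2 + d t" for t
  proof -
    have "(cmod (z0 + of_real (sqrt u) * unit_circle t))\<^sup>2 =
      (cmod z0)\<^sup>2 + 2 * Re (cnj z0 * (of_real (sqrt u) * unit_circle t)) + (cmod (of_real (sqrt u) * unit_circle t))\<^sup>2"
      unfolding cmod_power2 by (simp add: power2_eq_square algebra_simps)
    moreover have "(cmod (of_real (sqrt u) * unit_circle t))\<^sup>2 = u"
      using u by (simp add: norm_mult)
    moreover have "2 * Re (cnj z0 * (of_real (sqrt u) * unit_circle t)) = Re (w * unit_circle t)"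
    proof -
      have "w * unit_circle t = cnj z0 * (of_real (sqrt u) * unit_circle t) + cnj z0 * (of_real (sqrt u) * unit_circle t)"
        by (simp add: w_def)
      then show ?thesis by (simp only: plus_complex.sel mult_2)
    qed
    ultimately show ?thesis by (simp add: d_def)
  qed
  have dR: "\<bar>d t\<bar> \<le> R * sqrt u" for t
  proof -
    have "\<bar>Re (w * unit_circle t)\<bar> \<le> cmod (w * unit_circle t)" by (rule abs_Re_le_cmod)
    also have "\<dots> = 2 * cmod z0 * sqrt u" using u by (simp add: w_def norm_mult)
    finally have "\<bar>d t\<bar> \<le> 2 * cmod z0 * sqrt u + u" unfolding d_def using u by linarith
    with su show ?thesis by (simp add: R_def algebra_simps)
  qed
  have dcont: "continuous_on {0..1} d" unfolding d_def by (intro continuous_intros)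
  have dint: "(d has_integral u) {0..1}"
    unfolding d_def using has_integral_add[OF circle_mean_Re(1)[of w] has_integral_const_real[of u 0 1]] by simp
  have d2int: "((\<lambda>t. (d t)\<^sup>2) has_integral 2 * (cmod z0)\<^sup>2 * u + u\<^sup>2) {0..1}"
  proof -
    have "((\<lambda>t. (Re (w * unit_circle t))\<^sup>2 + 2 * u * Re (w * unit_circle t) + u\<^sup>2) has_integral
        (cmod w)\<^sup>2 / 2 + 2 * u * 0 + u\<^sup>2) {0..1}"
      using has_integral_const_real[of "u\<^sup>2" 0 1]
      by (intro has_integral_add has_integral_mult_right circle_mean_Re) simp
    moreover have "(cmod w)\<^sup>2 / 2 = 2 * (cmod z0)\<^sup>2 * u"
      using u by (simp add: w_def norm_mult power_mult_distrib)
    moreover have "(Re (w * unit_circle t))\<^sup>2 + 2 * u * Re (w * unit_circle t) + u\<^sup>2 = (d t)\<^sup>2" for t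
      unfolding d_def power2_sum by (simp only: mult_ac add_ac)
    ultimately show ?thesis by simp
  qed
  define q where "q = (\<lambda>t. G0 + G1 * d t + G2 / 2 * (d t)\<^sup>2)"
  have qcont: "continuous_on {0..1} q" unfolding q_def by (intro continuous_intros dcont)
  have qint: "(\<integral>t. q t \<partial>lborel_Icc 0 1) = G0 + G1 * u + G2 / 2 * (2 * (cmod z0)\<^sup>2 * u + u\<^sup>2)"
  proof (rule integral_lborel_Icc_continuous(2)[OF qcont])
    show "(q has_integral G0 + G1 * u + G2 / 2 * (2 * (cmod z0)\<^sup>2 * u + u\<^sup>2)) {0..1}"
      unfolding q_def using has_integral_const_real[of G0 0 1]
      by (intro has_integral_add has_integral_mult_right dint d2int) simp
  qed
  have bd: "\<bar>G ((cmod z0)\<^sup>2 + d t) - q t\<bar> \<le> C * R ^ 3 * (sqrt u * u)" for t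
  proof -
    have "\<bar>G ((cmod z0)\<^sup>2 + d t) - q t\<bar> \<le> C * \<bar>d t\<bar> ^ 3"
      unfolding q_def using dR[of t] u(3) by (intro taylor) (simp add: R_def)
    also have "\<dots> \<le> C * (R * sqrt u) ^ 3"
      using assms(3) dR by (intro mult_left_mono power_mono) auto
    also have "\<dots> = C * R ^ 3 * (sqrt u * u)"
      using u by (simp add: power_mult_distrib power3_eq_cube)
    finally show ?thesis .
  qed
  note [measurable] = measurable_id_lborel_Icc
  have Emeas: "(\<lambda>t. G ((cmod z0)\<^sup>2 + d t) - q t) \<in> borel_measurable (lborel_Icc 0 1)"
    unfolding d_def q_def by measurable
  have Eint: "integrable (lborel_Icc 0 1) (\<lambda>t. G ((cmod z0)\<^sup>2 + d t) - q t)"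
    by (rule T.integrable_const_bound[OF _ Emeas, of "C * R ^ 3 * (sqrt u * u)"]) (use bd in auto)
  have "(\<integral>t. G ((cmod (z0 + of_real (sqrt u) * unit_circle t))\<^sup>2) \<partial>lborel_Icc 0 1) =
      (\<integral>t. (G ((cmod z0)\<^sup>2 + d t) - q t) + q t \<partial>lborel_Icc 0 1)"
    by (simp add: d)
  also have "\<dots> = (\<integral>t. G ((cmod z0)\<^sup>2 + d t) - q t \<partial>lborel_Icc 0 1) + (\<integral>t. q t \<partial>lborel_Icc 0 1)"
    by (rule Bochner_Integration.integral_add[OF Eint integral_lborel_Icc_continuous(1)[OF qcont]])
  finally have eq: "(\<integral>t. G ((cmod (z0 + of_real (sqrt u) * unit_circle t))\<^sup>2) \<partial>lborel_Icc 0 1) - (G0 + (G1 + (cmod z0)\<^sup>2 * G2) * u)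
     = (\<integral>t. G ((cmod z0)\<^sup>2 + d t) - q t \<partial>lborel_Icc 0 1) + G2 / 2 * u\<^sup>2"
    unfolding qint by (simp add: algebra_simps)
  have "\<bar>\<integral>t. G ((cmod z0)\<^sup>2 + d t) - q t \<partial>lborel_Icc 0 1\<bar> \<le> (\<integral>t. \<bar>G ((cmod z0)\<^sup>2 + d t) - q t\<bar> \<partial>lborel_Icc 0 1)"
    by (rule integral_abs_bound)
  also have "\<dots> \<le> (\<integral>t. C * R ^ 3 * (sqrt u * u) \<partial>lborel_Icc 0 1)"
    using Eint bd by (intro integral_mono) auto
  also have "\<dots> = C * R ^ 3 * (sqrt u * u)" by (simp add: prob)
  finally have 1: "\<bar>\<integral>t. G ((cmod z0)\<^sup>2 + d t) - q t \<partial>lborel_Icc 0 1\<bar> \<le> C * R ^ 3 * (sqrt u * u)" .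
  have "\<bar>G2 / 2 * u\<^sup>2\<bar> \<le> \<bar>G2\<bar> * (sqrt u * u)"
  proof -
    have "u\<^sup>2 \<le> sqrt u * u" unfolding power2_eq_square using su u by (intro mult_right_mono) auto
    then have "\<bar>G2\<bar> / 2 * u\<^sup>2 \<le> \<bar>G2\<bar> * (sqrt u * u)" using u by (intro mult_mono) auto
    then show ?thesis by (simp add: abs_mult)
  qed
  with 1 show ?thesis
    unfolding eq R_def[symmetric] by (simp add: algebra_simps)
qed

text \<open>Divide by the mass of the bump. On the left continuity of p gives pi p(z0); on the right
  the remainder of the circle means contributes O(\<epsilon>^(3/2)), against a mass of order
  \<open>\<epsilon>\<close>.\<close>

lemma density_at_point:
  fixes p :: "complex \<Rightarrow> real" and G :: "real \<Rightarrow> real" and z0 :: complex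
  assumes p: "continuous_on UNIV p"
    and [measurable]: "G \<in> borel_measurable borel"
    and taylor: "\<And>\<delta>. \<bar>\<delta>\<bar> \<le> \<delta>0 \<Longrightarrow> \<bar>G ((cmod z0)\<^sup>2 + \<delta>) - (G0 + G1 * \<delta> + G2 / 2 * \<delta>\<^sup>2)\<bar> \<le> C * \<bar>\<delta>\<bar> ^ 3"
    and "C \<ge> 0" "\<delta>0 > 0"
    and density: "\<And>\<epsilon>. \<epsilon> > 0 \<Longrightarrow> (\<integral>z. p z * bump 0 (1 - (cmod (z - z0))\<^sup>2 / \<epsilon>) \<partial>lborel) =
      (\<integral>u. (\<integral>t. bump_lap \<epsilon> u * G ((cmod (z0 + of_real (sqrt u) * unit_circle t))\<^sup>2) \<partial>lborel_Icc 0 1) \<partial>lborel_Icc 0 \<epsilon>)"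
  shows "pi * p z0 = G1 + (cmod z0)\<^sup>2 * G2"
proof -
  define D where "D = G1 + (cmod z0)\<^sup>2 * G2"
  define R where "R = 2 * cmod z0 + 1"
  have R: "R > 0" by (simp add: R_def add_nonneg_pos)
  define C' where "C' = C * R ^ 3 + \<bar>G2\<bar>"
  have C': "C' \<ge> 0" using assms(4) R by (simp add: C'_def)
  obtain Q where Q: "Q > 0" "\<And>\<epsilon> u. \<epsilon> > 0 \<Longrightarrow> u \<in> {0..\<epsilon>} \<Longrightarrow> \<bar>bump_lap \<epsilon> u\<bar> \<le> Q / \<epsilon>"
    by (rule bump_lap_bound) blast
  note [measurable] = borel_measurable_continuous_onI[OF p]
  have "\<bar>pi * p z0 - D\<bar> \<le> e" if "e > 0" for e
  proof -
    have "e / (2 * pi) > 0" using that by simp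
    then obtain \<rho> where \<rho>: "\<rho> > 0" "\<And>z. dist z z0 < \<rho> \<Longrightarrow> dist (p z) (p z0) < e / (2 * pi)"
      using p unfolding continuous_on_iff by blast
    \<comment> \<open>The remainder is at most (Q / \<epsilon>) (C' s \<epsilon>) over an interval
      of length \<epsilon>, that is Q C' s \<epsilon>. Replacing \<epsilon> by the mass costs 2 exp
      2, the inverse of the constant in \<open>bump_mass_lower\<close>.\<close>
    define b where "b = 2 * exp 2 * Q * C'"
    have b: "b \<ge> 0" using Q C' by (simp add: b_def)
    \<comment> \<open>One entry for each demand: u \<le> 1, continuity of p, the range of the Taylor
      estimate, and a remainder below e / 2. The \<open>b + 1\<close> avoids a zero
      denominator.\<close>
    define s where "s = Min {1, \<rho> / 2, \<delta>0 / R, e / (2 * (b + 1))}"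
    have s: "s > 0" "s \<le> 1" "s < \<rho>" "R * s \<le> \<delta>0" "b * s \<le> e / 2"
    proof -
      show "s > 0" using \<rho> R assms(5) that b by (auto simp: s_def)
      show "s \<le> 1" by (auto simp: s_def)
      have "s \<le> \<rho> / 2" unfolding s_def by (rule Min_le) auto
      then show "s < \<rho>" using \<rho> by simp
      have "s \<le> \<delta>0 / R" unfolding s_def by (rule Min_le) auto
      then show "R * s \<le> \<delta>0" using R by (simp add: field_simps)
      have "s \<le> e / (2 * (b + 1))" unfolding s_def by (rule Min_le) auto
      then have "(b + 1) * s \<le> e / 2" using b by (simp add: field_simps)
      then show "b * s \<le> e / 2" using \<open>s > 0\<close> by (simp add: algebra_simps)
    qed
    \<comment> \<open>The bump then vanishes outside the disc of radius \<open>s\<close>.\<close>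
    define \<epsilon> where "\<epsilon> = s\<^sup>2"
    have \<epsilon>: "\<epsilon> > 0" "sqrt \<epsilon> = s" "\<epsilon> \<le> 1" using s by (auto simp: \<epsilon>_def power_le_one)
    define H where "H = bump_mass \<epsilon>"
    have H: "H \<ge> exp (-2) / 2 * \<epsilon>" unfolding H_def by (rule bump_mass_lower[OF \<epsilon>(1)])
    have H0: "H > 0" using H \<epsilon> by (smt (verit) exp_gt_zero half_gt_zero mult_pos_pos)
    define \<phi> where "\<phi> = (\<lambda>z. bump 0 (1 - (cmod (z - z0))\<^sup>2 / \<epsilon>))"
    define I where "I = (\<integral>z. p z * \<phi> z \<partial>lborel)"
    have [measurable]: "\<phi> \<in> borel_measurable borel" unfolding \<phi>_def by measurable
    have \<phi>: "integrable lborel \<phi>" "(\<integral>z. \<phi> z \<partial>lborel) = pi * H" "\<And>z. \<phi> z \<ge> 0"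
      using bump_radial_integral[OF \<epsilon>(1), of z0] unfolding \<phi>_def H_def
      by (auto simp: has_bochner_integral_iff bump_nonneg)
    have near: "\<bar>(p z - p z0) * \<phi> z\<bar> \<le> e / (2 * pi) * \<phi> z" for z
    proof (cases "dist z z0 < \<rho>")
      case True
      then show ?thesis
        unfolding abs_mult abs_of_nonneg[OF \<phi>(3)] using \<rho>(2)[OF True] \<phi>(3)[of z]
        by (intro mult_right_mono) (auto simp: dist_real_def)
    next
      case False
      then have "\<epsilon> \<le> (cmod (z - z0))\<^sup>2" unfolding \<epsilon>_def using s by (intro power_mono) (auto simp: dist_norm)
      then have "1 \<le> (cmod (z - z0))\<^sup>2 / \<epsilon>" using \<epsilon>(1) by (subst le_divide_eq_1_pos)
      then have "\<phi> z = 0" unfolding \<phi>_def by (intro bump_eq_0) simp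
      then show ?thesis by simp
    qed
    have int1: "integrable lborel (\<lambda>z. (p z - p z0) * \<phi> z)"
      by (rule Bochner_Integration.integrable_bound[OF integrable_mult_right[OF \<phi>(1), of "e / (2 * pi)"]])
         (use near \<phi>(3) that in \<open>auto simp: abs_mult\<close>)
    have "I = (\<integral>z. (p z - p z0) * \<phi> z + p z0 * \<phi> z \<partial>lborel)"
      by (simp add: I_def algebra_simps)
    also have "\<dots> = (\<integral>z. (p z - p z0) * \<phi> z \<partial>lborel) + p z0 * (pi * H)"
      using int1 \<phi> by (subst Bochner_Integration.integral_add) auto
    finally have "\<bar>I - p z0 * (pi * H)\<bar> = \<bar>\<integral>z. (p z - p z0) * \<phi> z \<partial>lborel\<bar>" by simp
    also have "\<dots> \<le> (\<integral>z. \<bar>(p z - p z0) * \<phi> z\<bar> \<partial>lborel)"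
      by (rule integral_abs_bound)
    also have "\<dots> \<le> (\<integral>z. e / (2 * pi) * \<phi> z \<partial>lborel)"
      using near int1 \<phi>(1) by (intro integral_mono) auto
    also have "\<dots> = e / 2 * H" using \<phi>(2) by simp
    finally have 1: "\<bar>I - p z0 * (pi * H)\<bar> \<le> e / 2 * H" .

    interpret T: finite_measure "lborel_Icc 0 1" by (rule finite_measure_lborel_Icc)
    interpret U: finite_measure "lborel_Icc 0 \<epsilon>" by (rule finite_measure_lborel_Icc)
    define m where "m = (\<lambda>u. \<integral>t. G ((cmod (z0 + of_real (sqrt u) * unit_circle t))\<^sup>2) \<partial>lborel_Icc 0 1)"
    note [measurable] = measurable_id_lborel_Icc fst_measurable_lborel_Icc snd_measurable_lborel_Icc
    have [measurable]: "m \<in> borel_measurable (lborel_Icc 0 \<epsilon>)" unfolding m_def by measurable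
    have m: "\<bar>m u - (G0 + D * u)\<bar> \<le> C' * (s * \<epsilon>)" if u: "u \<in> {0..\<epsilon>}" for u
    proof -
      have "R * sqrt u \<le> R * s" using u \<epsilon> R by (intro mult_left_mono) auto
      then have "\<bar>m u - (G0 + D * u)\<bar> \<le> C' * (sqrt u * u)"
        unfolding m_def D_def C'_def R_def
        using u \<epsilon> assms(4) s(4) by (intro circle_mean_taylor[OF _ taylor]) (auto simp: R_def)
      also have "\<dots> \<le> C' * (s * \<epsilon>)"
        using u \<epsilon> C' s by (intro mult_left_mono mult_mono) auto
      finally show ?thesis .
    qed
    define E where "E = (\<lambda>u. bump_lap \<epsilon> u * (m u - (G0 + D * u)))"
    have E: "\<bar>E u\<bar> \<le> Q / \<epsilon> * (C' * (s * \<epsilon>))" if "u \<in> {0..\<epsilon>}" for u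
      unfolding E_def abs_mult using m[OF that] Q(2)[OF \<epsilon>(1) that] Q(1) \<epsilon>(1) by (intro mult_mono) auto
    have [measurable]: "bump_lap \<epsilon> \<in> borel_measurable (lborel_Icc 0 \<epsilon>)"
      by (intro measurable_lborel_Icc_borel) measurable
    have E_int: "integrable (lborel_Icc 0 \<epsilon>) E"
    proof (rule U.integrable_const_bound[of _ "Q / \<epsilon> * (C' * (s * \<epsilon>))"])
      show "AE u in lborel_Icc 0 \<epsilon>. norm (E u) \<le> Q / \<epsilon> * (C' * (s * \<epsilon>))"
        using E by (intro AE_I2) (auto simp: space_restrict_space)
      show "E \<in> borel_measurable (lborel_Icc 0 \<epsilon>)" unfolding E_def by measurable
    qed
    have qint: "integrable (lborel_Icc 0 \<epsilon>) (bump_lap \<epsilon>)" "integrable (lborel_Icc 0 \<epsilon>) (\<lambda>u. bump_lap \<epsilon> u * u)"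
      by (intro integral_lborel_Icc_continuous(1) continuous_intros bump_lap_continuous)+
    have "I = (\<integral>u. bump_lap \<epsilon> u * m u \<partial>lborel_Icc 0 \<epsilon>)"
      unfolding I_def \<phi>_def density[OF \<epsilon>(1)] m_def by simp
    also have "\<dots> = (\<integral>u. E u + (G0 * bump_lap \<epsilon> u + D * (bump_lap \<epsilon> u * u)) \<partial>lborel_Icc 0 \<epsilon>)"
      by (simp add: E_def algebra_simps)
    also have "\<dots> = (\<integral>u. E u \<partial>lborel_Icc 0 \<epsilon>) + (G0 * 0 + D * H)"
      using E_int qint by (simp add: H_def bump_lap_moments[OF \<epsilon>(1)])
    finally have "\<bar>I - D * H\<bar> = \<bar>\<integral>u. E u \<partial>lborel_Icc 0 \<epsilon>\<bar>" by simp
    also have "\<dots> \<le> (\<integral>u. \<bar>E u\<bar> \<partial>lborel_Icc 0 \<epsilon>)" by (rule integral_abs_bound)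
    also have "\<dots> \<le> (\<integral>u. Q / \<epsilon> * (C' * (s * \<epsilon>)) \<partial>lborel_Icc 0 \<epsilon>)"
      using E E_int by (intro integral_mono) (auto simp: space_restrict_space)
    also have "\<dots> = Q * C' * s * \<epsilon>"
      using \<epsilon> by (simp add: space_restrict_space measure_restrict_space)
    also have "\<dots> \<le> Q * C' * s * (2 * exp 2 * H)"
    proof (rule mult_left_mono)
      show "\<epsilon> \<le> 2 * exp 2 * H" using H by (simp add: exp_minus field_simps)
    qed (use Q C' s in auto)
    also have "\<dots> = (b * s) * H" by (simp add: b_def)
    also have "\<dots> \<le> e / 2 * H" using s H0 by (intro mult_right_mono) auto
    finally have 2: "\<bar>I - D * H\<bar> \<le> e / 2 * H" .
    have "\<bar>pi * p z0 - D\<bar> * H = \<bar>p z0 * (pi * H) - D * H\<bar>"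
      using H0 abs_mult[of "pi * p z0 - D" H] by (simp add: algebra_simps)
    also have "\<dots> \<le> e * H" using 1 2 by linarith
    finally show ?thesis using H0 by simp
  qed
  then have "\<bar>pi * p z0 - D\<bar> \<le> 0" by (rule field_le_epsilon) simp
  then show ?thesis by (simp add: D_def)
qed

subsection \<open>Scaling limit of the kernel\<close>

definition exp_moment :: "nat \<Rightarrow> real \<Rightarrow> real" where
  "exp_moment n s = integral {0..1} (\<lambda>t. t ^ n * exp (s * t))"

lemma exp_moment_deriv: "(exp_moment n has_real_derivative exp_moment (Suc n) s) (at s)"
proof -
  have "((\<lambda>s. integral (cbox 0 1) (\<lambda>t. t ^ n * exp (s * t))) has_field_derivative
     integral (cbox 0 1) (\<lambda>t. t ^ Suc n * exp (s * t))) (at s within UNIV)"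
    by (rule leibniz_rule_field_derivative)
       (auto intro!: derivative_eq_intros continuous_intros integrable_continuous_real simp: split_beta' simp del: power_Suc, simp)
  then show ?thesis by (simp add: exp_moment_def[abs_def])
qed

lemma exp_moment_0: "exp_moment 0 = g_fun"
proof
  fix s :: real
  show "exp_moment 0 s = g_fun s"
  proof (cases "s = 0")
    case False
    have "((\<lambda>t. exp (s * t)) has_integral exp (s * 1) / s - exp (s * 0) / s) {0..1}"
      using False by (intro fundamental_theorem_of_calculus)
       (auto intro!: derivative_eq_intros simp: has_real_derivative_iff_has_vector_derivative[symmetric])
    then show ?thesis using False by (simp add: exp_moment_def g_fun_def integral_unique diff_divide_distrib)
  qed (simp add: exp_moment_def g_fun_def)
qed

lemma g_fun_iterated_deriv: "(deriv ^^ n) g_fun = exp_moment n"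
proof (induction n)
  case (Suc n)
  have "deriv (exp_moment n) = exp_moment (Suc n)"
    using exp_moment_deriv[of n] by (auto intro!: DERIV_imp_deriv)
  with Suc show ?case by simp
qed (simp add: exp_moment_0)

text \<open>Compare exp (s t) with exp (- A) and exp A on [0, 1]. The positive lower bound, uniform
  in s, is what permits division by g^(L-1) later.\<close>

lemma exp_moment_bounds:
  assumes "\<bar>s\<bar> \<le> A"
  shows "exp_moment n s \<ge> exp (- A) / real (Suc n)" and "exp_moment n s \<le> exp A"
proof -
  have *: "\<bar>s * t\<bar> \<le> A" if "t \<in> {0..1}" for t
    using that assms mult_mono[of "\<bar>s\<bar>" A "\<bar>t\<bar>" 1] by (auto simp: abs_mult)
  have "((\<lambda>t::real. t ^ n * exp (- A)) has_integral (1 ^ Suc n / real (Suc n) * exp (- A) - 0 ^ Suc n / real (Suc n) * exp (- A))) {0..1}"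
    by (intro fundamental_theorem_of_calculus)
       (auto intro!: derivative_eq_intros simp: has_real_derivative_iff_has_vector_derivative[symmetric] simp del: power_Suc)
  then have "exp (- A) / real (Suc n) = integral {0..1} (\<lambda>t::real. t ^ n * exp (- A))"
    by (subst integral_unique) auto
  also have "\<dots> \<le> exp_moment n s"
    unfolding exp_moment_def
  proof (intro integral_le integrable_continuous_real continuous_intros mult_left_mono)
    fix t :: real assume t: "t \<in> {0..1}"
    show "exp (- A) \<le> exp (s * t)" using *[OF t] by simp
    show "0 \<le> t ^ n" using t by simp
  qed
  finally show "exp_moment n s \<ge> exp (- A) / real (Suc n)" .
  have "exp_moment n s \<le> integral {0..1} (\<lambda>t::real. exp A)"
    unfolding exp_moment_def
  proof (intro integral_le integrable_continuous_real continuous_intros)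
    fix t :: real assume t: "t \<in> {0..1}"
    have "t ^ n * exp (s * t) \<le> 1 * exp A"
      using t *[OF t] by (intro mult_mono power_le_one) auto
    then show "t ^ n * exp (s * t) \<le> exp A" by simp
  qed
  then show "exp_moment n s \<le> exp A" by simp
qed

text \<open>Induction over the cells: a left endpoint value errs by at most |K| / N^2 on one cell,
  and k = N cells give the rate 1 / N.\<close>

lemma riemann_sum_lipschitz:
  fixes f :: "real \<Rightarrow> real"
  assumes lip: "\<And>x y. x \<in> {0..1} \<Longrightarrow> y \<in> {0..1} \<Longrightarrow> \<bar>f x - f y\<bar> \<le> K * \<bar>x - y\<bar>"
    and cont: "continuous_on {0..1} f" and N: "N \<ge> 1" and k: "k \<le> N"
  shows "\<bar>integral {0..real k / real N} f - (\<Sum>m<k. f (real m / real N)) / real N\<bar> \<le> real k * (\<bar>K\<bar> / (real N)\<^sup>2)"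
  using k
proof (induction k)
  case (Suc k)
  let ?a = "real k / real N" and ?b = "real (Suc k) / real N"
  have ab: "0 \<le> ?a" "?a \<le> ?b" "?b \<le> 1" using Suc.prems N by (auto simp: divide_simps)
  have ba: "?b - ?a = 1 / real N" by (simp add: add_divide_distrib)
  have c: "continuous_on {0..?b} f" "continuous_on {?a..?b} f"
    using ab by (intro continuous_on_subset[OF cont], auto)+
  have split: "integral {0..?b} f = integral {0..?a} f + integral {?a..?b} f"
    using ab c by (intro Henstock_Kurzweil_Integration.integral_combine[symmetric] integrable_continuous_real) auto
  have const: "integral {?a..?b} (\<lambda>x. f ?a) = f ?a / real N"
    using ab ba by simp
  have "integral {?a..?b} f - f ?a / real N = integral {?a..?b} (\<lambda>x. f x - f ?a)"
    unfolding const[symmetric] using c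
    by (intro Henstock_Kurzweil_Integration.integral_diff[symmetric] integrable_continuous_real) auto
  also have "norm \<dots> \<le> \<bar>K\<bar> / real N * (?b - ?a)"
  proof (rule integral_bound)
    fix x assume x: "x \<in> {?a..?b}"
    have "0 \<le> x" using ab(1) x by (meson atLeastAtMost_iff order_trans)
    then have "x \<in> {0..1}" "?a \<in> {0..1}" using x ab unfolding atLeastAtMost_iff by linarith+
    then have "norm (f x - f ?a) \<le> K * \<bar>x - ?a\<bar>" using lip[of x ?a] by simp
    also have "\<dots> \<le> \<bar>K\<bar> * (1 / real N)" using x ba by (intro mult_mono) auto
    finally show "norm (f x - f ?a) \<le> \<bar>K\<bar> / real N" by simp
  qed (use ab c in \<open>auto intro!: continuous_intros\<close>)
  finally have "\<bar>integral {?a..?b} f - f ?a / real N\<bar> \<le> \<bar>K\<bar> / (real N)\<^sup>2"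
    unfolding ba by (simp add: power2_eq_square)
  moreover have "\<bar>integral {0..?a} f - (\<Sum>m<k. f (real m / real N)) / real N\<bar> \<le> real k * (\<bar>K\<bar> / (real N)\<^sup>2)"
    using Suc by simp
  moreover have "real (Suc k) * (\<bar>K\<bar> / (real N)\<^sup>2) = real k * (\<bar>K\<bar> / (real N)\<^sup>2) + \<bar>K\<bar> / (real N)\<^sup>2"
    by (simp add: algebra_simps add_divide_distrib)
  moreover have "(\<Sum>m<Suc k. f (real m / real N)) / real N = (\<Sum>m<k. f (real m / real N)) / real N + f ?a / real N"
    by (simp add: add_divide_distrib)
  ultimately show ?case unfolding split by linarith
qed simp

lemma exp_moment_riemann:
  assumes "\<bar>s\<bar> \<le> A" "N \<ge> 1"
  shows "\<bar>(\<Sum>m<N. (real m / real N) ^ n * exp (s * real m / real N)) / real N - exp_moment n s\<bar> \<le> ((real n + A) * exp A) / real N"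
proof -
  have A: "A \<ge> 0" using assms by linarith
  let ?f = "\<lambda>t::real. t ^ n * exp (s * t)"
  \<comment> \<open>The constant bounds the derivative n t^(n-1) e^(s t) + s t^n e^(s t) on
    [0, 1].\<close>
  have lip: "\<bar>?f x - ?f y\<bar> \<le> ((real n + A) * exp A) * \<bar>x - y\<bar>" if xy: "x \<in> {0..1}" "y \<in> {0..1}" for x y
  proof -
    have "norm (?f x - ?f y) \<le> ((real n + A) * exp A) * norm (x - y)"
    proof (rule field_differentiable_bound[of "{0..1}"])
      fix t :: real assume t: "t \<in> {0..1}"
      show "(?f has_field_derivative (real n * t ^ (n - 1) * exp (s * t) + t ^ n * (s * exp (s * t)))) (at t within {0..1})"
        by (auto intro!: derivative_eq_intros)
      have st: "\<bar>s * t\<bar> \<le> A"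
        using t assms A mult_mono[of "\<bar>s\<bar>" A "\<bar>t\<bar>" 1] by (auto simp: abs_mult)
      have "\<bar>real n * t ^ (n - 1) * exp (s * t)\<bar> \<le> real n * 1 * exp A"
        unfolding abs_mult using t st by (intro mult_mono) (auto intro!: power_le_one)
      moreover have "\<bar>t ^ n * (s * exp (s * t))\<bar> \<le> 1 * (A * exp A)"
        unfolding abs_mult using t st assms A by (intro mult_mono) (auto intro!: power_le_one)
      ultimately show "norm (real n * t ^ (n - 1) * exp (s * t) + t ^ n * (s * exp (s * t))) \<le> (real n + A) * exp A"
        by (simp add: algebra_simps)
    qed (use xy in auto)
    then show ?thesis by simp
  qed
  have "\<bar>integral {0..real N / real N} ?f - (\<Sum>m<N. ?f (real m / real N)) / real N\<bar> \<le> real N * (\<bar>(real n + A) * exp A\<bar> / (real N)\<^sup>2)"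
    using assms by (intro riemann_sum_lipschitz lip continuous_intros) auto
  then show ?thesis
    using assms A by (simp add: exp_moment_def abs_minus_commute power2_eq_square)
qed

section \<open>Calculus of uniform approximation with error O(1/N)\<close>

text \<open>The limit is required to be bounded so that the relation is closed under products.\<close>

definition unif_approx :: "(nat \<Rightarrow> 'i set) \<Rightarrow> (nat \<Rightarrow> 'i \<Rightarrow> real) \<Rightarrow> (nat \<Rightarrow> 'i \<Rightarrow> real) \<Rightarrow> bool" where
  "unif_approx S f g \<longleftrightarrow> (\<exists>C>0. \<exists>N0\<ge>1. \<forall>N\<ge>N0. \<forall>i\<in>S N. \<bar>f N i - g N i\<bar> \<le> C / real N \<and> \<bar>g N i\<bar> \<le> C)"

lemma unif_approxI:
  assumes "\<And>N i. N \<ge> N0 \<Longrightarrow> N \<ge> 1 \<Longrightarrow> i \<in> S N \<Longrightarrow> \<bar>f N i - g N i\<bar> \<le> C / real N"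
    and "\<And>N i. N \<ge> N0 \<Longrightarrow> N \<ge> 1 \<Longrightarrow> i \<in> S N \<Longrightarrow> \<bar>g N i\<bar> \<le> B"
  shows "unif_approx S f g"
  unfolding unif_approx_def
proof (intro exI conjI allI ballI impI)
  let ?C = "\<bar>C\<bar> + \<bar>B\<bar> + 1"
  show "?C > 0" "max 1 N0 \<ge> 1" by auto
  fix N i assume *: "N \<ge> max 1 N0" "i \<in> S N"
  then have "\<bar>f N i - g N i\<bar> \<le> C / real N" by (intro assms) auto
  also have "\<dots> \<le> ?C / real N" by (intro divide_right_mono) auto
  finally show "\<bar>f N i - g N i\<bar> \<le> ?C / real N" .
  show "\<bar>g N i\<bar> \<le> ?C" using assms(2)[of N i] * by auto
qed

lemma unif_approxE:
  assumes "unif_approx S f g"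
  obtains C N0 where "C > 0" "N0 \<ge> 1" "\<And>N i. N \<ge> N0 \<Longrightarrow> i \<in> S N \<Longrightarrow> \<bar>f N i - g N i\<bar> \<le> C / real N"
    "\<And>N i. N \<ge> N0 \<Longrightarrow> i \<in> S N \<Longrightarrow> \<bar>g N i\<bar> \<le> C" "\<And>N i. N \<ge> N0 \<Longrightarrow> i \<in> S N \<Longrightarrow> \<bar>f N i\<bar> \<le> 2 * C"
proof -
  from assms obtain C N0 where *: "C > 0" "N0 \<ge> 1" "\<And>N i. N \<ge> N0 \<Longrightarrow> i \<in> S N \<Longrightarrow> \<bar>f N i - g N i\<bar> \<le> C / real N"
    "\<And>N i. N \<ge> N0 \<Longrightarrow> i \<in> S N \<Longrightarrow> \<bar>g N i\<bar> \<le> C"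
    unfolding unif_approx_def by blast
  have "\<bar>f N i\<bar> \<le> 2 * C" if "N \<ge> N0" "i \<in> S N" for N i
  proof -
    have "C / real N \<le> C / 1" using that *(1,2) by (intro divide_left_mono) auto
    then show ?thesis using *(3,4)[OF that] by linarith
  qed
  with * show ?thesis using that by blast
qed

lemma unif_approx_refl:
  assumes "\<And>N i. N \<ge> 1 \<Longrightarrow> i \<in> S N \<Longrightarrow> \<bar>g N i\<bar> \<le> B"
  shows "unif_approx S g g"
  by (rule unif_approxI[of 1 _ _ _ 0 B]) (use assms in auto)

lemma unif_approx_add:
  assumes "unif_approx S f1 g1" "unif_approx S f2 g2"
  shows "unif_approx S (\<lambda>N i. f1 N i + f2 N i) (\<lambda>N i. g1 N i + g2 N i)"
proof -
  obtain C1 N1 where 1: "\<And>N i. N \<ge> N1 \<Longrightarrow> i \<in> S N \<Longrightarrow> \<bar>f1 N i - g1 N i\<bar> \<le> C1 / real N"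
    "\<And>N i. N \<ge> N1 \<Longrightarrow> i \<in> S N \<Longrightarrow> \<bar>g1 N i\<bar> \<le> C1" using unif_approxE[OF assms(1)] by metis
  obtain C2 N2 where 2: "\<And>N i. N \<ge> N2 \<Longrightarrow> i \<in> S N \<Longrightarrow> \<bar>f2 N i - g2 N i\<bar> \<le> C2 / real N"
    "\<And>N i. N \<ge> N2 \<Longrightarrow> i \<in> S N \<Longrightarrow> \<bar>g2 N i\<bar> \<le> C2" using unif_approxE[OF assms(2)] by metis
  show ?thesis
  proof (rule unif_approxI[of "max N1 N2" _ _ _ "C1 + C2" "C1 + C2"])
    fix N i assume "N \<ge> max N1 N2" "i \<in> S N"
    then show "\<bar>(f1 N i + f2 N i) - (g1 N i + g2 N i)\<bar> \<le> (C1 + C2) / real N" "\<bar>g1 N i + g2 N i\<bar> \<le> C1 + C2"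
      using 1[of N i] 2[of N i] by (auto simp: add_divide_distrib)
  qed
qed

lemma unif_approx_mult:
  assumes "unif_approx S f1 g1" "unif_approx S f2 g2"
  shows "unif_approx S (\<lambda>N i. f1 N i * f2 N i) (\<lambda>N i. g1 N i * g2 N i)"
proof -
  obtain C1 N1 where 1: "C1 > 0" "\<And>N i. N \<ge> N1 \<Longrightarrow> i \<in> S N \<Longrightarrow> \<bar>f1 N i - g1 N i\<bar> \<le> C1 / real N"
    "\<And>N i. N \<ge> N1 \<Longrightarrow> i \<in> S N \<Longrightarrow> \<bar>g1 N i\<bar> \<le> C1" using unif_approxE[OF assms(1)] by metis
  obtain C2 N2 where 2: "C2 > 0" "\<And>N i. N \<ge> N2 \<Longrightarrow> i \<in> S N \<Longrightarrow> \<bar>f2 N i - g2 N i\<bar> \<le> C2 / real N"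
    "\<And>N i. N \<ge> N2 \<Longrightarrow> i \<in> S N \<Longrightarrow> \<bar>g2 N i\<bar> \<le> C2"
    "\<And>N i. N \<ge> N2 \<Longrightarrow> i \<in> S N \<Longrightarrow> \<bar>f2 N i\<bar> \<le> 2 * C2" using unif_approxE[OF assms(2)] by metis
  show ?thesis
  proof (rule unif_approxI[of "max N1 N2" _ _ _ "3 * C1 * C2" "C1 * C2"])
    fix N i assume *: "N \<ge> max N1 N2" "i \<in> S N"
    have "f1 N i * f2 N i - g1 N i * g2 N i = (f1 N i - g1 N i) * f2 N i + g1 N i * (f2 N i - g2 N i)"
      by (simp add: algebra_simps)
    also have "\<bar>\<dots>\<bar> \<le> \<bar>f1 N i - g1 N i\<bar> * \<bar>f2 N i\<bar> + \<bar>g1 N i\<bar> * \<bar>f2 N i - g2 N i\<bar>"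
      by (rule order_trans[OF abs_triangle_ineq]) (simp add: abs_mult)
    also have "\<dots> \<le> C1 / real N * (2 * C2) + C1 * (C2 / real N)"
      using 1 2 * by (intro add_mono mult_mono) auto
    also have "\<dots> = 3 * C1 * C2 / real N" by (simp add: field_simps)
    finally show "\<bar>f1 N i * f2 N i - g1 N i * g2 N i\<bar> \<le> 3 * C1 * C2 / real N" .
    show "\<bar>g1 N i * g2 N i\<bar> \<le> C1 * C2"
      unfolding abs_mult using 1 2 * by (intro mult_mono) auto
  qed
qed

lemma unif_approx_prod:
  assumes "finite I" "\<And>j. j \<in> I \<Longrightarrow> unif_approx S (f j) (g j)"
  shows "unif_approx S (\<lambda>N i. \<Prod>j\<in>I. f j N i) (\<lambda>N i. \<Prod>j\<in>I. g j N i)"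
  using assms
proof (induction I rule: finite_induct)
  case empty
  show ?case by (simp add: unif_approx_refl[where B = 1])
next
  case (insert x F)
  then show ?case using unif_approx_mult[of S "f x" "g x"] by simp
qed

lemma unif_approx_inverse:
  assumes "unif_approx S f g" "c > 0" "\<And>N i. i \<in> S N \<Longrightarrow> g N i \<ge> c"
  shows "unif_approx S (\<lambda>N i. inverse (f N i)) (\<lambda>N i. inverse (g N i))"
proof -
  obtain C N0 where C: "C > 0" "\<And>N i. N \<ge> N0 \<Longrightarrow> i \<in> S N \<Longrightarrow> \<bar>f N i - g N i\<bar> \<le> C / real N"
    using unif_approxE[OF assms(1)] by metis
  \<comment> \<open>From this index on the error is at most c / 2, so the approximants stay above c
    / 2.\<close>
  define N1 where "N1 = nat \<lceil>2 * C / c\<rceil>"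
  show ?thesis
  proof (rule unif_approxI[of "max N0 N1" _ _ _ "2 * C / c\<^sup>2" "1 / c"])
    fix N i assume *: "N \<ge> max N0 N1" "i \<in> S N" "N \<ge> 1"
    have g: "g N i \<ge> c" using * assms(3) by blast
    have "2 * C / c \<le> real N" using * unfolding N1_def by linarith
    then have "C / real N \<le> c / 2" using assms(2) *(3) by (simp add: field_simps)
    moreover have "\<bar>f N i - g N i\<bar> \<le> C / real N" using C(2) * by simp
    ultimately have f: "f N i \<ge> c / 2" using g by linarith
    have "inverse (f N i) - inverse (g N i) = (g N i - f N i) / (f N i * g N i)"
      using f g assms(2) by (simp add: field_simps)
    also have "\<bar>\<dots>\<bar> = \<bar>f N i - g N i\<bar> / (f N i * g N i)"
      using f g assms(2) by (simp add: abs_mult abs_minus_commute)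
    also have "\<dots> \<le> (C / real N) / (c / 2 * c)"
      using C(1) C(2)[of N i] * f g assms(2) by (intro frac_le mult_mono) auto
    also have "\<dots> = 2 * C / c\<^sup>2 / real N" by (simp add: power2_eq_square mult_ac)
    finally show "\<bar>inverse (f N i) - inverse (g N i)\<bar> \<le> 2 * C / c\<^sup>2 / real N" .
    show "\<bar>inverse (g N i)\<bar> \<le> 1 / c" using g assms(2) by (simp add: divide_simps)
  qed
qed

lemma unif_approx_trans:
  assumes "unif_approx S f g" "unif_approx S g h"
  shows "unif_approx S f h"
proof -
  obtain C1 N1 where 1: "\<And>N i. N \<ge> N1 \<Longrightarrow> i \<in> S N \<Longrightarrow> \<bar>f N i - g N i\<bar> \<le> C1 / real N"
    using unif_approxE[OF assms(1)] by metis
  obtain C2 N2 where 2: "\<And>N i. N \<ge> N2 \<Longrightarrow> i \<in> S N \<Longrightarrow> \<bar>g N i - h N i\<bar> \<le> C2 / real N"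
    "\<And>N i. N \<ge> N2 \<Longrightarrow> i \<in> S N \<Longrightarrow> \<bar>h N i\<bar> \<le> C2" using unif_approxE[OF assms(2)] by metis
  show ?thesis
  proof (rule unif_approxI[of "max N1 N2" _ _ _ "C1 + C2" C2])
    fix N i assume "N \<ge> max N1 N2" "i \<in> S N"
    then show "\<bar>f N i - h N i\<bar> \<le> (C1 + C2) / real N" "\<bar>h N i\<bar> \<le> C2"
      using 1[of N i] 2[of N i] by (auto simp: add_divide_distrib)
  qed
qed

text \<open>psi has N + 1 terms, a left Riemann sum has N. Dropping the term m = N costs 2 C / N,
  which together with the termwise error C / N gives 3 C.\<close>

lemma unif_approx_average:
  assumes "unif_approx (\<lambda>N. S \<times> {..N}) f g"
  shows "unif_approx (\<lambda>N. S) (\<lambda>N s. (\<Sum>m\<le>N. f N (s, m)) / real N) (\<lambda>N s. (\<Sum>m<N. g N (s, m)) / real N)"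
proof -
  obtain C N0 where C: "C > 0" "N0 \<ge> 1" "\<And>N i. N \<ge> N0 \<Longrightarrow> i \<in> S \<times> {..N} \<Longrightarrow> \<bar>f N i - g N i\<bar> \<le> C / real N"
    "\<And>N i. N \<ge> N0 \<Longrightarrow> i \<in> S \<times> {..N} \<Longrightarrow> \<bar>g N i\<bar> \<le> C" "\<And>N i. N \<ge> N0 \<Longrightarrow> i \<in> S \<times> {..N} \<Longrightarrow> \<bar>f N i\<bar> \<le> 2 * C"
    by (rule unif_approxE[OF assms]) blast
  show ?thesis
  proof (rule unif_approxI[of N0 _ _ _ "3 * C" C])
    fix N s assume *: "N \<ge> N0" "s \<in> S" "N \<ge> 1"
    have "\<bar>\<Sum>m<N. f N (s, m) - g N (s, m)\<bar> \<le> (\<Sum>m<N. C / real N)"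
      using C * by (intro order_trans[OF sum_abs] sum_mono) auto
    also have "\<dots> = C" using * by simp
    finally have "\<bar>(\<Sum>m<N. f N (s, m)) - (\<Sum>m<N. g N (s, m))\<bar> \<le> C" by (simp add: sum_subtractf)
    moreover have "(\<Sum>m\<le>N. f N (s, m)) = (\<Sum>m<N. f N (s, m)) + f N (s, N)"
      by (simp flip: lessThan_Suc_atMost)
    moreover have "\<bar>f N (s, N)\<bar> \<le> 2 * C" using C(5)[of N "(s, N)"] * by auto
    ultimately have "\<bar>(\<Sum>m\<le>N. f N (s, m)) - (\<Sum>m<N. g N (s, m))\<bar> \<le> 3 * C" by linarith
    then show "\<bar>(\<Sum>m\<le>N. f N (s, m)) / real N - (\<Sum>m<N. g N (s, m)) / real N\<bar> \<le> 3 * C / real N"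
      using divide_right_mono[of _ "3 * C" "real N"] by (simp add: diff_divide_distrib[symmetric])
    have "\<bar>\<Sum>m<N. g N (s, m)\<bar> \<le> (\<Sum>m<N. C)"
      using C * by (intro order_trans[OF sum_abs] sum_mono) auto
    then show "\<bar>(\<Sum>m<N. g N (s, m)) / real N\<bar> \<le> C" using * by (simp add: field_simps)
  qed
qed

section \<open>Kernel derivatives and the density formula\<close>

definition su11_kernel_deriv :: "nat \<Rightarrow> nat \<Rightarrow> nat \<Rightarrow> real \<Rightarrow> real" where
  "su11_kernel_deriv L N j x =
     (\<Sum>m\<le>N. real ((m + L - 1) choose m) * (\<Prod>i<j. real m - real i) * x ^ (m - j))"

lemma su11_kernel_deriv_0: "su11_kernel_deriv L N 0 = su11_kernel L N"
  by (simp add: su11_kernel_deriv_def su11_kernel_def fun_eq_iff)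

lemma su11_kernel_deriv_Suc:
  "(su11_kernel_deriv L N j has_real_derivative su11_kernel_deriv L N (Suc j) x) (at x)"
proof -
  have "((\<lambda>x. (\<Prod>i<j. real m - real i) * x ^ (m - j)) has_real_derivative
     (\<Prod>i<Suc j. real m - real i) * x ^ (m - Suc j)) (at x)" for m
  proof (cases "m < j")
    case True
    \<comment> \<open>The falling factorial contains the factor m - m, so the truncated exponents
      \<open>m - j\<close> and \<open>m - Suc j\<close> do no harm.\<close>
    then have zero: "(\<Prod>i<j. real m - real i) = 0" by (intro prod_zero) auto
    show ?thesis unfolding prod.lessThan_Suc zero by simp
  next
    case False
    then have *: "real m - real j = real (m - j)" by simp
    have "((\<lambda>x. x ^ (m - j)) has_real_derivative real (m - j) * x ^ (m - Suc j)) (at x)"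
      by (auto intro!: derivative_eq_intros)
    then show ?thesis unfolding prod.lessThan_Suc * mult.assoc by (intro DERIV_cmult)
  qed
  then show ?thesis
    unfolding su11_kernel_deriv_def mult.assoc by (intro DERIV_sum DERIV_cmult)
qed

text \<open>Within distance x0 / 2 of x0 the argument stays positive and the kernel is at least 1,
  so the logarithm is smooth there. The cubic constant bounds its third derivative on this compact
  interval.\<close>

lemma su11_ln_kernel_taylor:
  fixes L N :: nat and x0 :: real
  assumes "x0 > 0"
  defines "k \<equiv> su11_kernel_deriv L N"
  obtains C \<delta>0 where "C \<ge> 0" "\<delta>0 > 0"
    "\<And>\<delta>. \<bar>\<delta>\<bar> \<le> \<delta>0 \<Longrightarrow> \<bar>ln (k 0 (x0 + \<delta>)) - (ln (k 0 x0) + k 1 x0 / k 0 x0 * \<delta> +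
        (k 2 x0 / k 0 x0 - (k 1 x0 / k 0 x0)\<^sup>2) / 2 * \<delta>\<^sup>2)\<bar> \<le> C * \<bar>\<delta>\<bar> ^ 3"
proof -
  define \<delta>0 where "\<delta>0 = x0 / 2"
  have pos: "k 0 x > 0" if "x \<ge> 0" for x
    using su11_kernel_ge_1[OF that, of L N] unfolding k_def su11_kernel_deriv_0 by simp
  have dk: "(k j has_real_derivative k (Suc j) x) (at x)" for j x
    unfolding k_def by (rule su11_kernel_deriv_Suc)
  \<comment> \<open>\<open>d n\<close> is the n-th derivative of \<open>ln (k 0 x)\<close>; the last
    branch keeps the raw form that the quotient and power rules deliver.\<close>
  define d where "d = (\<lambda>(n::nat) x. if n = 0 then ln (k 0 x) else if n = 1 then k 1 x / k 0 x
     else if n = 2 then k 2 x / k 0 x - (k 1 x / k 0 x)\<^sup>2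
     else (k 3 x * k 0 x - k 2 x * k 1 x) / (k 0 x * k 0 x) - 2 * (k 1 x / k 0 x) * ((k 2 x * k 0 x - k 1 x * k 1 x) / (k 0 x * k 0 x)))"
  have d1: "((\<lambda>x. k 1 x / k 0 x) has_real_derivative (k 2 x * k 0 x - k 1 x * k 1 x) / (k 0 x * k 0 x)) (at x)"
    if "x \<ge> 0" for x
    using DERIV_divide[OF dk[of 1 x] dk[of 0 x]] pos[OF that] by (simp add: numeral_2_eq_2)
  have D: "(d n has_real_derivative d (Suc n) x) (at x)" if x: "x \<ge> 0" and n: "n < 3" for n x
  proof -
    note k0 = pos[OF x]
    have "(d 0 has_real_derivative d 1 x) (at x)"
      using DERIV_chain2[OF DERIV_ln_divide[OF k0] dk[of 0 x]] by (simp add: d_def)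
    moreover have "(d 1 has_real_derivative d 2 x) (at x)"
      using d1[OF x] k0 by (simp add: d_def diff_divide_distrib power2_eq_square)
    moreover have "(d 2 has_real_derivative d 3 x) (at x)"
    proof -
      have "((\<lambda>x. k 2 x / k 0 x) has_real_derivative (k 3 x * k 0 x - k 2 x * k 1 x) / (k 0 x * k 0 x)) (at x)"
        using DERIV_divide[OF dk[of 2 x] dk[of 0 x]] k0 by (simp add: eval_nat_numeral)
      from DERIV_diff[OF this DERIV_power[OF d1[OF x], of 2]]
      show ?thesis by (simp add: d_def mult_ac)
    qed
    moreover have "n = 0 \<or> n = 1 \<or> n = 2" using n by auto
    ultimately show ?thesis by (auto simp: eval_nat_numeral)
  qed
  have kc: "continuous_on S (k j)" for S j
    by (meson dk DERIV_isCont continuous_at_imp_continuous_on)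
  have "continuous_on {x0 - \<delta>0..x0 + \<delta>0} (d 3)"
    unfolding d_def using pos assms(1) by (auto intro!: continuous_intros kc simp: \<delta>0_def less_imp_neq[THEN not_sym])
  then have "compact (d 3 ` {x0 - \<delta>0..x0 + \<delta>0})" by (intro compact_continuous_image) auto
  then obtain B where B: "B > 0" "\<And>x. x \<in> {x0 - \<delta>0..x0 + \<delta>0} \<Longrightarrow> \<bar>d 3 x\<bar> \<le> B"
    using compact_imp_bounded bounded_pos by (metis imageI real_norm_def)
  show ?thesis
  proof (rule that[of B \<delta>0])
    show "B \<ge> 0" "\<delta>0 > 0" using B assms by (auto simp: \<delta>0_def)
    fix \<delta> assume \<delta>: "\<bar>\<delta>\<bar> \<le> \<delta>0"
    show "\<bar>ln (k 0 (x0 + \<delta>)) - (ln (k 0 x0) + k 1 x0 / k 0 x0 * \<delta> + (k 2 x0 / k 0 x0 - (k 1 x0 / k 0 x0)\<^sup>2) / 2 * \<delta>\<^sup>2)\<bar> \<le> B * \<bar>\<delta>\<bar> ^ 3"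
    proof (cases "\<delta> = 0")
      case False
      have "\<exists>t. (if x0 + \<delta> < x0 then x0 + \<delta> < t \<and> t < x0 else x0 < t \<and> t < x0 + \<delta>) \<and>
         d 0 (x0 + \<delta>) = (\<Sum>m<3. (d m x0 / fact m) * ((x0 + \<delta>) - x0) ^ m) + (d 3 t / fact 3) * ((x0 + \<delta>) - x0) ^ 3"
      proof (rule Taylor[of 3 d "d 0" "x0 - \<delta>0" "x0 + \<delta>0" x0 "x0 + \<delta>"])
        show "\<forall>m t. m < 3 \<and> x0 - \<delta>0 \<le> t \<and> t \<le> x0 + \<delta>0 \<longrightarrow> (d m has_real_derivative d (Suc m) t) (at t)"
          using assms(1) by (auto intro!: D simp: \<delta>0_def)
      qed (use \<delta> False in auto)
      then obtain t where t0: "if x0 + \<delta> < x0 then x0 + \<delta> < t \<and> t < x0 else x0 < t \<and> t < x0 + \<delta>"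
        and t1: "d 0 (x0 + \<delta>) = (\<Sum>m<3. (d m x0 / fact m) * ((x0 + \<delta>) - x0) ^ m) + (d 3 t / fact 3) * ((x0 + \<delta>) - x0) ^ 3"
        by blast
      have t: "t \<in> {x0 - \<delta>0..x0 + \<delta>0}"
        "d 0 (x0 + \<delta>) = (\<Sum>m<3. (d m x0 / fact m) * \<delta> ^ m) + (d 3 t / fact 3) * \<delta> ^ 3"
        using \<delta> t0 t1 by (auto split: if_splits)
      have "(\<Sum>m<3. (d m x0 / fact m) * \<delta> ^ m) = d 0 x0 + d 1 x0 * \<delta> + d 2 x0 / 2 * \<delta>\<^sup>2"
        by (simp add: eval_nat_numeral)
      then have "d 0 (x0 + \<delta>) - (d 0 x0 + d 1 x0 * \<delta> + d 2 x0 / 2 * \<delta>\<^sup>2) = d 3 t / fact 3 * \<delta> ^ 3"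
        using t(2) by simp
      also have "\<bar>\<dots>\<bar> = \<bar>d 3 t\<bar> / 6 * \<bar>\<delta>\<bar> ^ 3"
        by (simp add: abs_mult power_abs fact_numeral)
      also have "\<dots> \<le> B * \<bar>\<delta>\<bar> ^ 3"
        using B(2)[OF t(1)] by (intro mult_right_mono) auto
      finally show ?thesis by (simp add: d_def)
    qed simp
  qed
qed

text \<open>The Edelman--Kostlan formula; the right-hand side is \<open>d/dx (x d/dx ln (K x))\<close>.\<close>

lemma su11_density:
  fixes L N :: nat and z0 :: complex and M :: "'w measure" and a :: "nat \<Rightarrow> 'w \<Rightarrow> complex" and p :: "complex \<Rightarrow> real"
  assumes L: "L \<ge> 1" and P: "prob_space M"
    and indep: "prob_space.indep_vars M (\<lambda>_. borel) a UNIV"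
    and gauss: "\<And>m. distributed M lborel (a m) (\<lambda>z. ennreal (std_cgauss_density z))"
    and p_cont: "continuous_on UNIV p"
    and p_density: "\<And>\<phi>. test_function \<phi> \<Longrightarrow>
        prob_space.expectation M (\<lambda>\<omega>. zero_sum (su11_poly L N (\<lambda>m. a m \<omega>)) \<phi>) = integral\<^sup>L lborel (\<lambda>z. p z * \<phi> z)"
    and "z0 \<noteq> 0"
  defines "k \<equiv> su11_kernel_deriv L N"
  defines "x \<equiv> (cmod z0)\<^sup>2"
  shows "pi * p z0 = k 1 x / k 0 x + x * (k 2 x / k 0 x - (k 1 x / k 0 x)\<^sup>2)"
proof -
  interpret prob_space M by (rule P)
  have x: "x > 0" using assms(7) by (simp add: x_def)
  define K where "K = 2 * ln_cgauss_mean"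
  define G where "G = (\<lambda>y. ln (su11_kernel L N y) + K)"
  obtain C \<delta>0 where C: "C \<ge> 0" "\<delta>0 > 0"
    "\<And>\<delta>. \<bar>\<delta>\<bar> \<le> \<delta>0 \<Longrightarrow> \<bar>ln (k 0 (x + \<delta>)) - (ln (k 0 x) + k 1 x / k 0 x * \<delta> + (k 2 x / k 0 x - (k 1 x / k 0 x)\<^sup>2) / 2 * \<delta>\<^sup>2)\<bar> \<le> C * \<bar>\<delta>\<bar> ^ 3"
    unfolding k_def using su11_ln_kernel_taylor[OF x, of L N] by metis
  have law: "distr M borel (a m) = density lborel (\<lambda>z. ennreal (cgauss 1 z))" for m
    using gauss[of m] unfolding distributed_def cgauss_1 by (metis distr_cong sets_lborel)
  have meas: "G \<in> borel_measurable borel" unfolding G_def su11_kernel_def by measurable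
  have taylor: "\<bar>G (x + \<delta>) - (ln (k 0 x) + K + k 1 x / k 0 x * \<delta> + (k 2 x / k 0 x - (k 1 x / k 0 x)\<^sup>2) / 2 * \<delta>\<^sup>2)\<bar> \<le> C * \<bar>\<delta>\<bar> ^ 3"
    if "\<bar>\<delta>\<bar> \<le> \<delta>0" for \<delta>
    using C(3)[OF that] by (simp add: G_def k_def su11_kernel_deriv_0 algebra_simps)
  have density: "(\<integral>z. p z * bump 0 (1 - (cmod (z - z0))\<^sup>2 / \<epsilon>) \<partial>lborel) =
      (\<integral>u. (\<integral>t. bump_lap \<epsilon> u * G ((cmod (z0 + of_real (sqrt u) * unit_circle t))\<^sup>2) \<partial>lborel_Icc 0 1) \<partial>lborel_Icc 0 \<epsilon>)"
    if "\<epsilon> > 0" for \<epsilon>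
    unfolding G_def K_def p_density[OF radial_bump_test_function[OF that], symmetric]
    by (rule expectation_zero_sum_bump[OF L that indep law])
  show ?thesis
    using density_at_point[OF p_cont meas taylor[unfolded x_def] C(1,2) density] unfolding x_def by simp
qed

section \<open>Asymptotics of the kernel derivatives near x = 1\<close>

lemma fact_mult_binomial_add:
  "fact r * real ((m + r) choose m) = (\<Prod>i<r. real m + 1 + real i)"
proof -
  have "fact (m + r) = fact m * (\<Prod>i<r. real m + 1 + real i)"
    by (induction r) (simp_all add: algebra_simps)
  moreover have "real ((m + r) choose m) = fact (m + r) / (fact m * fact r)"
    by (subst binomial_fact) auto
  ultimately show ?thesis by simp
qed

lemma unif_approx_shift:
  "unif_approx (\<lambda>N. S \<times> {..N}) (\<lambda>N i. (real (snd i) + c) / real N) (\<lambda>N i. real (snd i) / real N)"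
  by (rule unif_approxI[of 1 _ _ _ "\<bar>c\<bar>" 1]) (auto simp: add_divide_distrib)

lemma exp_diff_le:
  fixes x y A :: real
  assumes "x \<le> A" "y \<le> A"
  shows "\<bar>exp x - exp y\<bar> \<le> exp A * \<bar>x - y\<bar>"
proof -
  have "norm (exp x - exp y) \<le> exp A * norm (x - y)"
    using assms by (intro field_differentiable_bound[of "{..A}" exp exp]) (auto intro: DERIV_subset[OF DERIV_exp])
  then show ?thesis by simp
qed

lemma power_one_plus_approx_exp:
  fixes s A :: real
  assumes s: "\<bar>s\<bar> \<le> A" and N: "real N \<ge> A" "N \<ge> 1" and k: "k \<le> N"
  shows "\<bar>(1 + s / real N) ^ k - exp (s * real k / real N)\<bar> \<le> (exp (2 * A) * A\<^sup>2) / real N"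
proof -
  have A: "A \<ge> 0" using s by linarith
  define y where "y = s / real N"
  \<comment> \<open>The bound k |a - b| for a^k - b^k requires |a|, |b| \<le> 1, so both bases are
    divided by \<open>M\<close>, which dominates 1 + y and exp y. Undoing this costs only M^k \<le>
    exp A.\<close>
  define M where "M = exp (A / real N)"
  have yA: "\<bar>y\<bar> \<le> A / real N" using s N by (simp add: y_def divide_right_mono)
  have y1: "\<bar>y\<bar> \<le> 1" using yA N order_trans[of "\<bar>y\<bar>" "A / real N" 1] by simp
  have AN: "A / real N \<le> A" using A N by (simp add: divide_le_eq mult_left_le_one_le mult_le_cancel_left1)
  have M0: "M > 0" by (simp add: M_def)
  have a: "\<bar>(1 + y) / M\<bar> \<le> 1"
  proof -
    have "1 + y \<le> exp y" by (rule exp_ge_add_one_self)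
    also have "\<dots> \<le> M" unfolding M_def using yA by simp
    finally show ?thesis using y1 M0 by (simp add: abs_le_iff divide_le_eq)
  qed
  have b: "\<bar>exp y / M\<bar> \<le> 1"
    using yA M0 by (simp add: M_def)
  \<comment> \<open>A second-order error of size 1 / N^2 per factor; at most N factors turn it into
    the rate 1 / N.\<close>
  have e: "\<bar>1 + y - exp y\<bar> \<le> exp A * (A / real N)\<^sup>2"
  proof -
    have "\<bar>exp y - (\<Sum>i\<le>1. y ^ i / fact i)\<bar> \<le> exp \<bar>y\<bar> * (\<bar>y\<bar> ^ Suc 1) / fact 1"
      using Taylor_exp_field[of y 1] by simp
    then have "\<bar>1 + y - exp y\<bar> \<le> exp \<bar>y\<bar> * \<bar>y\<bar>\<^sup>2"
      by (simp add: abs_minus_commute numeral_2_eq_2)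
    also have "\<dots> \<le> exp A * (A / real N)\<^sup>2"
      using yA AN by (intro mult_mono power_mono) auto
    finally show ?thesis .
  qed
  have "norm (((1 + y) / M) ^ k - (exp y / M) ^ k) \<le> real k * norm ((1 + y) / M - exp y / M)"
    using a b by (intro norm_power_diff) auto
  also have "norm ((1 + y) / M - exp y / M) = \<bar>1 + y - exp y\<bar> / M"
    using M0 by (simp add: diff_divide_distrib[symmetric])
  also have "\<dots> \<le> \<bar>1 + y - exp y\<bar> / 1"
    using A N by (intro divide_left_mono) (auto simp: M_def)
  also have "\<dots> \<le> exp A * (A / real N)\<^sup>2" using e by simp
  finally have 1: "\<bar>((1 + y) / M) ^ k - (exp y / M) ^ k\<bar> \<le> real k * (exp A * (A / real N)\<^sup>2)"
    by (simp add: mult_left_mono)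
  have "(1 + y) ^ k - exp y ^ k = M ^ k * (((1 + y) / M) ^ k - (exp y / M) ^ k)"
    using M0 by (simp add: power_divide algebra_simps)
  also have "\<bar>\<dots>\<bar> = M ^ k * \<bar>((1 + y) / M) ^ k - (exp y / M) ^ k\<bar>"
    using M0 by (simp add: abs_mult)
  also have "\<dots> \<le> exp A * (real k * (exp A * (A / real N)\<^sup>2))"
  proof (rule mult_mono)
    have "M ^ k = exp (real k * (A / real N))" by (simp add: M_def exp_of_nat_mult[symmetric])
    also have "\<dots> \<le> exp A" using k N A by (simp add: field_simps mult_left_mono)
    finally show "M ^ k \<le> exp A" .
  qed (use 1 in auto)
  also have "\<dots> \<le> exp A * (real N * (exp A * (A / real N)\<^sup>2))"
    using k by (intro mult_left_mono mult_right_mono) auto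
  also have "\<dots> = (exp (2 * A) * A\<^sup>2) / real N"
    using N by (simp add: power2_eq_square exp_add[symmetric] field_simps mult_exp_exp)
  finally have "\<bar>(1 + y) ^ k - exp y ^ k\<bar> \<le> (exp (2 * A) * A\<^sup>2) / real N" .
  moreover have "exp y ^ k = exp (s * real k / real N)"
    by (simp add: y_def exp_of_nat_mult[symmetric] mult.commute)
  ultimately show ?thesis by (simp add: y_def)
qed

text \<open>Two errors add up: replacing 1 + s / N by exp (s / N), and then the exponent m - j by m.
  Even when truncated, m - j differs from m by at most j, which costs exp A * A * j / N.\<close>

lemma unif_approx_power_exp:
  assumes "A > 0"
  shows "unif_approx (\<lambda>N. {-A..A} \<times> {..N}) (\<lambda>N i. (1 + fst i / real N) ^ (snd i - j))
     (\<lambda>N i. exp (fst i * real (snd i) / real N))"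
proof (rule unif_approxI[of "nat \<lceil>A\<rceil>" _ _ _ "exp (2 * A) * A\<^sup>2 + exp A * (A * real j)" "exp A"])
  fix N :: nat and i :: "real \<times> nat" assume N: "nat \<lceil>A\<rceil> \<le> N" "1 \<le> N" and i: "i \<in> {-A..A} \<times> {..N}"
  obtain s m where sm: "i = (s, m)" by (cases i)
  have s: "\<bar>s\<bar> \<le> A" and m: "m \<le> N" using i sm by auto
  have AN: "A \<le> real N" using N by linarith
  have le: "s * real k / real N \<le> A" if "k \<le> N" for k
  proof -
    have "s * real k \<le> A * real N" using s that assms by (intro mult_mono) auto
    then show ?thesis using N by (simp add: divide_le_eq)
  qed
  have "\<bar>(1 + s / real N) ^ (m - j) - exp (s * real (m - j) / real N)\<bar> \<le> (exp (2 * A) * A\<^sup>2) / real N"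
    using s AN N m by (intro power_one_plus_approx_exp) auto
  moreover have "\<bar>exp (s * real (m - j) / real N) - exp (s * real m / real N)\<bar> \<le> exp A * (A * real j) / real N"
  proof -
    have "\<bar>exp (s * real (m - j) / real N) - exp (s * real m / real N)\<bar> \<le> exp A * \<bar>s * real (m - j) / real N - s * real m / real N\<bar>"
      using m by (intro exp_diff_le le) auto
    also have "s * real (m - j) / real N - s * real m / real N = s * (real (m - j) - real m) / real N"
      by (simp add: diff_divide_distrib algebra_simps)
    also have "\<bar>\<dots>\<bar> = \<bar>s\<bar> * \<bar>real (m - j) - real m\<bar> / real N" by (simp add: abs_mult)
    also have "\<dots> \<le> A * real j / real N"
      using s assms by (intro divide_right_mono mult_mono) auto
    finally show ?thesis by (simp add: mult_left_mono)
  qed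
  ultimately show "\<bar>(1 + fst i / real N) ^ (snd i - j) - exp (fst i * real (snd i) / real N)\<bar> \<le> (exp (2 * A) * A\<^sup>2 + exp A * (A * real j)) / real N"
    unfolding sm fst_conv snd_conv add_divide_distrib by linarith
  show "\<bar>exp (fst i * real (snd i) / real N)\<bar> \<le> exp A"
    using le[OF m] by (simp add: sm)
qed

text \<open>Here r = L - 1. In the exponent r + j + 1, r comes from the binomial coefficient (r!
  times it is a product of r factors close to m), j from the falling factorial, and 1 is the mesh of
  the Riemann sum.\<close>

lemma su11_kernel_scaling_limit:
  assumes "A > 0"
  shows "unif_approx (\<lambda>N. {-A..A})
    (\<lambda>N s. fact r * su11_kernel_deriv (Suc r) N j (1 + s / real N) / real N ^ (r + j + 1)) (\<lambda>N. exp_moment (r + j))"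
proof -
  define f where "f = (\<lambda>N i. (\<Prod>l<r. (real (snd i) + (1 + real l)) / real N) * (\<Prod>l<j. (real (snd i) + (- real l)) / real N) *
      (1 + fst i / real N) ^ (snd i - j))"
  define g where "g = (\<lambda>N i. (\<Prod>l<r. real (snd i) / real N) * (\<Prod>l<j. real (snd i) / real N) * exp (fst i * real (snd i) / real N))"
  have "unif_approx (\<lambda>N. {-A..A} \<times> {..N}) f g"
    unfolding f_def g_def
    by (intro unif_approx_mult unif_approx_prod unif_approx_shift unif_approx_power_exp assms) auto
  then have "unif_approx (\<lambda>N. {-A..A}) (\<lambda>N s. (\<Sum>m\<le>N. f N (s, m)) / real N) (\<lambda>N s. (\<Sum>m<N. g N (s, m)) / real N)"
    by (rule unif_approx_average)
  moreover have "unif_approx (\<lambda>N. {-A..A}) (\<lambda>N s. (\<Sum>m<N. g N (s, m)) / real N) (\<lambda>N. exp_moment (r + j))"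
  proof (rule unif_approxI[of 1 _ _ _ "(real (r + j) + A) * exp A" "exp A"])
    fix N :: nat and s assume N: "N \<ge> 1" and s: "s \<in> {-A..A}"
    then have sA: "\<bar>s\<bar> \<le> A" by auto
    have "g N (s, m) = (real m / real N) ^ (r + j) * exp (s * real m / real N)" for m
      by (simp add: g_def power_add)
    then show "\<bar>(\<Sum>m<N. g N (s, m)) / real N - exp_moment (r + j) s\<bar> \<le> (real (r + j) + A) * exp A / real N"
      using exp_moment_riemann[OF sA N, of "r + j"] by simp
    have "exp_moment (r + j) s \<ge> 0"
      using exp_moment_bounds(1)[OF sA, of "r + j"] by (rule order_trans[rotated]) simp
    then show "\<bar>exp_moment (r + j) s\<bar> \<le> exp A" using exp_moment_bounds(2)[OF sA] by simp
  qed
  ultimately have "unif_approx (\<lambda>N. {-A..A}) (\<lambda>N s. (\<Sum>m\<le>N. f N (s, m)) / real N) (\<lambda>N. exp_moment (r + j))"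
    by (rule unif_approx_trans)
  moreover have "(\<Sum>m\<le>N. f N (s, m)) / real N = fact r * su11_kernel_deriv (Suc r) N j (1 + s / real N) / real N ^ (r + j + 1)" for N s
  proof -
    have "f N (s, m) = fact r * (real ((m + Suc r - 1) choose m) * (\<Prod>i<j. real m - real i) * (1 + s / real N) ^ (m - j)) / real N ^ (r + j)" for m
      using fact_mult_binomial_add[of r m]
      by (simp add: f_def prod_dividef power_add mult.assoc[symmetric] add.assoc)
    then show ?thesis
      by (simp add: su11_kernel_deriv_def sum_distrib_left sum_divide_distrib mult.commute)
  qed
  ultimately show ?thesis by simp
qed

theorem theorem1:
  fixes L :: nat and A :: real
    and M :: "'w measure" and a :: "nat \<Rightarrow> 'w \<Rightarrow> complex"
    and p :: "nat \<Rightarrow> complex \<Rightarrow> real"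
  assumes L: "L \<ge> 1" and A: "A > 0"
    and P: "prob_space M"
    and indep: "prob_space.indep_vars M (\<lambda>_. borel) a UNIV"
    and gauss: "\<And>m. distributed M lborel (a m) (\<lambda>z. ennreal (std_cgauss_density z))"
    and p_cont: "\<And>N. N \<ge> 1 \<Longrightarrow> continuous_on UNIV (p N)"
    and p_nonneg: "\<And>N z. N \<ge> 1 \<Longrightarrow> p N z \<ge> 0"
    and p_density: "\<And>N \<phi>. N \<ge> 1 \<Longrightarrow> test_function \<phi> \<Longrightarrow>
        prob_space.expectation M (\<lambda>\<omega>. zero_sum (su11_poly L N (\<lambda>m. a m \<omega>)) \<phi>)
          = integral\<^sup>L lborel (\<lambda>z. p N z * \<phi> z)"
  shows "\<exists>C N0. \<forall>N\<ge>N0. \<forall>s\<in>{-A..A}. \<forall>\<theta>::real.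
    \<bar>p N (complex_of_real (sqrt (1 + s / real N)) * cis \<theta>) / (real N)\<^sup>2
      - (1 / pi) * deriv (\<lambda>t. (deriv ^^ L) g_fun t / (deriv ^^ (L - 1)) g_fun t) s\<bar>
    \<le> C / real N"
proof -
  obtain r where r: "L = Suc r" using L by (cases L) auto
  define k where "k = (\<lambda>N j s. su11_kernel_deriv L N j (1 + s / real N))"
  define X where "X = (\<lambda>j N s. fact r * k N j s / real N ^ (r + j + 1))"
  define S where "S = (\<lambda>N::nat. {-A..A})"
  have X: "unif_approx S (X j) (\<lambda>N. exp_moment (r + j))" for j
    unfolding X_def S_def k_def r by (rule su11_kernel_scaling_limit[OF A])
  have lower: "exp_moment r s \<ge> exp (- A) / real (Suc r)" if "s \<in> {-A..A}" for s
    using that by (intro exp_moment_bounds) auto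
  then have pos: "exp_moment r s > 0" if "s \<in> {-A..A}" for s
    using that by (meson exp_gt_zero divide_pos_pos less_le_trans of_nat_0_less_iff zero_less_Suc)
  have inv: "unif_approx S (\<lambda>N s. inverse (X 0 N s)) (\<lambda>N s. inverse (exp_moment r s))"
    using X[of 0] lower by (intro unif_approx_inverse[of _ _ _ "exp (- A) / real (Suc r)"]) (auto simp: S_def)
  have const: "unif_approx S (\<lambda>N s. 1 / real N) (\<lambda>N s. 0)"
    by (rule unif_approxI[of 1 _ _ _ 1 0]) auto
  have scale: "unif_approx S (\<lambda>N s. 1 + s / real N) (\<lambda>N s. 1)"
    using A by (intro unif_approxI[of 1 _ _ _ A 1]) (auto simp: S_def divide_right_mono)
  have neg: "unif_approx S (\<lambda>N s. - 1) (\<lambda>N s. - 1)"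
    by (rule unif_approx_refl[of _ _ 1]) simp
  \<comment> \<open>\<open>F\<close> is pi p / N^2 in normalised ratios. Since X 1 / X 0 already
    carries one factor 1 / N, the term K'/K keeps a spare 1 / N and disappears in the limit.\<close>
  define F where "F = (\<lambda>N s. (1 / real N) * (X 1 N s * inverse (X 0 N s)) +
     (1 + s / real N) * (X 2 N s * inverse (X 0 N s) + (- 1) * ((X 1 N s * inverse (X 0 N s)) * (X 1 N s * inverse (X 0 N s)))))"
  \<comment> \<open>Kept in the shape of \<open>F\<close>, with 0 and 1 as the limits of 1 / N and
    x, so that the sum and product rules apply literally. Its value is the derivative of g^(L) /
    g^(L-1).\<close>
  define H where "H = (\<lambda>s. 0 * (exp_moment (r + 1) s * inverse (exp_moment r s)) +
     1 * (exp_moment (r + 2) s * inverse (exp_moment r s) +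
       (- 1) * ((exp_moment (r + 1) s * inverse (exp_moment r s)) * (exp_moment (r + 1) s * inverse (exp_moment r s)))))"
  have "unif_approx S F (\<lambda>N. H)"
    unfolding F_def H_def by (intro unif_approx_add unif_approx_mult const scale neg inv X)
  then obtain C N1 where C: "C > 0" "\<And>N s. N \<ge> N1 \<Longrightarrow> s \<in> {-A..A} \<Longrightarrow> \<bar>F N s - H s\<bar> \<le> C / real N"
    unfolding S_def by (rule unif_approxE) blast
  \<comment> \<open>The \<open>+ 1\<close> makes N > A strict, so that 1 + s / N is positive even at
    s = - A.\<close>
  define N0 where "N0 = max N1 (nat \<lceil>A\<rceil> + 1)"
  have "\<bar>p N (complex_of_real (sqrt (1 + s / real N)) * cis \<theta>) / (real N)\<^sup>2
      - (1 / pi) * deriv (\<lambda>t. (deriv ^^ L) g_fun t / (deriv ^^ (L - 1)) g_fun t) s\<bar> \<le> (C / pi) / real N"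
    if N: "N \<ge> N0" and s: "s \<in> {-A..A}" for N s and \<theta> :: real
  proof -
    have N': "N \<ge> N1" "N \<ge> 1" "real N > A" using N unfolding N0_def by (auto, linarith)
    define x where "x = 1 + s / real N"
    have x: "x > 0" using N' s A by (simp add: x_def field_simps)
    define z where "z = complex_of_real (sqrt x) * cis \<theta>"
    have z: "(cmod z)\<^sup>2 = x" "z \<noteq> 0" using x by (auto simp: z_def norm_mult)
    have density: "pi * p N z = k N 1 s / k N 0 s + x * (k N 2 s / k N 0 s - (k N 1 s / k N 0 s)\<^sup>2)"
      using su11_density[OF L P indep gauss p_cont[OF N'(2)] p_density[OF N'(2)] z(2)]
      unfolding z(1) by (simp add: k_def x_def)
    have k0: "k N 0 s > 0"
      using su11_kernel_ge_1[of x L N] x unfolding k_def x_def[symmetric] su11_kernel_deriv_0 by simp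
    \<comment> \<open>The factorial and the common power of N cancel; each order of differentiation
      leaves one factor 1 / N.\<close>
    have ratio: "X j N s * inverse (X 0 N s) = k N j s / k N 0 s / real N ^ j" for j
      using k0 N'(2) by (simp add: X_def field_simps power_add)
    have "F N s = (pi * p N z) / (real N)\<^sup>2"
      unfolding F_def ratio density x_def[symmetric] using N'(2)
      by (simp add: field_simps power2_eq_square)
    then have pF: "p N z / (real N)\<^sup>2 = F N s / pi" by simp
    have "((\<lambda>t. exp_moment (r + 1) t / exp_moment r t) has_real_derivative
        (exp_moment (r + 2) s * exp_moment r s - exp_moment (r + 1) s * exp_moment (r + 1) s) / (exp_moment r s * exp_moment r s)) (at s)"
      using DERIV_divide[OF exp_moment_deriv[of "r + 1" s] exp_moment_deriv[of r s]] pos[OF s] by simp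
    then have "deriv (\<lambda>t. (deriv ^^ L) g_fun t / (deriv ^^ (L - 1)) g_fun t) s = H s"
      using pos[OF s] unfolding g_fun_iterated_deriv r H_def by (subst DERIV_imp_deriv) (auto simp: field_simps)
    then have "\<bar>p N z / (real N)\<^sup>2 - (1 / pi) * deriv (\<lambda>t. (deriv ^^ L) g_fun t / (deriv ^^ (L - 1)) g_fun t) s\<bar> = \<bar>F N s - H s\<bar> / pi"
      unfolding pF by (simp add: diff_divide_distrib[symmetric])
    also have "\<dots> \<le> (C / real N) / pi"
      using C(2)[OF N'(1) s] by (intro divide_right_mono) auto
    finally show ?thesis by (simp add: z_def x_def mult.commute)
  qed
  then show ?thesis by blast
qed

end
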